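(* Let $0<\ell\le1$, $T>0$, $u_0\in L^2(0,\ell)$, $u_0\neq0$, and let $\alpha_1,\alpha_2\in[0,2)$. For $i=1,2$ let $u_i$ be the solution of the degenerate problem with power $\alpha_i$ (described in the context). If for some $t_0\in(0,T]$ we have $\partial_t u_1(x,t_0)=\partial_t u_2(x,t_0)$ and $\partial_x u_1(x,t_0)=\partial_x u_2(x,t_0)$ for all $x\in(0,\ell)$, then $\alpha_1=\alpha_2$.
   Context: For $\alpha\in[0,2)$, the degenerate problem with power $\alpha$ is $\partial_t u-\partial_x(x^\alpha\partial_x u)=0$ in $(0,\ell)\times(0,T)$, $u(x,0)=u_0(x)$, with boundary conditions $u(0,t)=u(\ell,t)=0$ if $0\le\alpha<1$ (weak degeneracy), and $x^\alpha\partial_x u(x,t)|_{x=0}=0$, $u(\ell,t)=0$ if $1\le\alpha<2$ (strong degeneracy). Its solution is $u(t)=e^{tA}u_0$, where $Au=\partial_x(x^\alpha\partial_xu)$ with domain $\{u\in H^1_\alpha(0,\ell): x^\alpha\partial_x u\in H^1(0,\ell)\}$ generates an analytic contraction semigroup on $L^2(0,\ell)$; here $H^1_\alpha(0,\ell)=\{u\in L^2:\int_0^\ell x^\alpha|\partial_xu|^2<\infty,\ u(0)=u(\ell)=0\}$ for $\alpha<1$ and $\{u\in L^2:\int_0^\ell x^\alpha|\partial_xu|^2<\infty,\ u(\ell)=0\}$ for $1\le\alpha<2$. *)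

theory Defs
  imports "HOL-Analysis.Analysis"
begin

text \<open>Real-valued functions on the interval (0,l) are represented by functions
  real => real; only their values on (0,l) matter and equalities are up to
  Lebesgue-a.e. equality on (0,l).\<close>

definition L2_on :: "real \<Rightarrow> (real \<Rightarrow> real) \<Rightarrow> bool" where
  "L2_on l f \<longleftrightarrow> set_integrable lborel {0<..<l} f
      \<and> set_integrable lborel {0<..<l} (\<lambda>x. (f x)\<^sup>2)"

definition L2_dist :: "real \<Rightarrow> (real \<Rightarrow> real) \<Rightarrow> (real \<Rightarrow> real) \<Rightarrow> real" where
  "L2_dist l f g = sqrt (LBINT x:{0<..<l}. (f x - g x)\<^sup>2)"

definition ae_eq_on :: "real \<Rightarrow> (real \<Rightarrow> real) \<Rightarrow> (real \<Rightarrow> real) \<Rightarrow> bool" where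
  "ae_eq_on l f g \<longleftrightarrow> (AE x in lborel. x \<in> {0<..<l} \<longrightarrow> f x = g x)"

definition weak_deriv :: "real \<Rightarrow> (real \<Rightarrow> real) \<Rightarrow> (real \<Rightarrow> real) \<Rightarrow> bool" where
  "weak_deriv l f g \<longleftrightarrow>
     (\<forall>a b. 0 < a \<longrightarrow> a \<le> b \<longrightarrow> b < l \<longrightarrow>
        set_integrable lborel {a..b} f \<and> set_integrable lborel {a..b} g) \<and>
     (\<forall>\<phi>. \<phi> C1_differentiable_on UNIV \<longrightarrow>
        (\<exists>a b. 0 < a \<and> a \<le> b \<and> b < l \<and> (\<forall>x. x \<notin> {a..b} \<longrightarrow> \<phi> x = 0)) \<longrightarrow>
        (LBINT x:{0<..<l}. f x * deriv \<phi> x) = - (LBINT x:{0<..<l}. g x * \<phi> x))"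

text \<open>Weighted space H^1_alpha(0,l) with its boundary conditions; u' is the weak
  derivative of u.  The trace conditions u(l)=0 and (for alpha<1) u(0)=0 are
  expressed via the absolutely continuous representative.\<close>
definition H1_alpha :: "real \<Rightarrow> real \<Rightarrow> (real \<Rightarrow> real) \<Rightarrow> (real \<Rightarrow> real) \<Rightarrow> bool" where
  "H1_alpha \<alpha> l u u' \<longleftrightarrow>
     L2_on l u \<and> weak_deriv l u u' \<and>
     set_integrable lborel {0<..<l} (\<lambda>x. x powr \<alpha> * (u' x)\<^sup>2) \<and>
     (AE x in lborel. x \<in> {0<..<l} \<longrightarrow> u x = - (LBINT s:{x..<l}. u' s)) \<and>
     (\<alpha> < 1 \<longrightarrow> (AE x in lborel. x \<in> {0<..<l} \<longrightarrow> u x = (LBINT s:{0<..x}. u' s)))"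

text \<open>gen_op alpha l u v: u belongs to D(A) and A u = v (as L^2 functions),
  where A u = (x^alpha u_x)_x and D(A) = {u in H^1_alpha : x^alpha u_x in H^1(0,l)}.\<close>
definition gen_op :: "real \<Rightarrow> real \<Rightarrow> (real \<Rightarrow> real) \<Rightarrow> (real \<Rightarrow> real) \<Rightarrow> bool" where
  "gen_op \<alpha> l u v \<longleftrightarrow>
     (\<exists>u'. H1_alpha \<alpha> l u u' \<and>
        L2_on l (\<lambda>x. x powr \<alpha> * u' x) \<and> L2_on l v \<and>
        weak_deriv l (\<lambda>x. x powr \<alpha> * u' x) v)"

definition has_L2_tderiv ::
  "real \<Rightarrow> real \<Rightarrow> (real \<Rightarrow> real \<Rightarrow> real) \<Rightarrow> real \<Rightarrow> (real \<Rightarrow> real) \<Rightarrow> bool" where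
  "has_L2_tderiv l T u t v \<longleftrightarrow> L2_on l v \<and>
     ((\<lambda>s. L2_dist l (\<lambda>x. (u s x - u t x) / (s - t)) v) \<longlongrightarrow> 0) (at t within {0<..T})"

text \<open>u solves the degenerate problem with power alpha on (0,l) x (0,T) with
  initial datum u0, i.e. t |-> u(t) = e^{tA} u0: the (unique) classical solution
  of the abstract Cauchy problem u' = A u, u(0) = u0 in L^2(0,l).\<close>
definition degenerate_solution ::
  "real \<Rightarrow> real \<Rightarrow> real \<Rightarrow> (real \<Rightarrow> real) \<Rightarrow> (real \<Rightarrow> real \<Rightarrow> real) \<Rightarrow> bool" where
  "degenerate_solution \<alpha> l T u0 u \<longleftrightarrow>
     (\<forall>t\<in>{0<..T}. \<exists>v. gen_op \<alpha> l (u t) v \<and> has_L2_tderiv l T u t v) \<and>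
     ((\<lambda>t. L2_dist l (u t) u0) \<longlongrightarrow> 0) (at_right 0)"

end

theory Submission
  imports Defs
begin

text \<open>
  Write \<open>w\<close> for the common space derivative at time \<open>t\<^sub>0\<close>. The fluxes \<open>x\<^bsup>\<alpha>1\<^esup> w\<close> and
  \<open>x\<^bsup>\<alpha>2\<^esup> w\<close> have the same weak derivative, so \<open>(x\<^bsup>\<alpha>1\<^esup> - x\<^bsup>\<alpha>2\<^esup>) w = c\<close> is constant.
  Let \<open>\<alpha>1 < \<alpha>2\<close> and suppose \<open>c \<noteq> 0\<close>. If \<open>\<alpha>1 < 1\<close>, then \<open>w\<close> has one sign, while the
  two boundary conditions force its integral to vanish. If \<open>\<alpha>1 \<ge> 1\<close>, then
  \<open>x\<^bsup>\<alpha>1\<^esup> w\<^sup>2 \<ge> c\<^sup>2 / x\<close> is not integrable. Hence \<open>w = 0\<close> and \<open>u\<^sub>1(t\<^sub>0) = 0\<close>.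

  The generator is symmetric: writing \<open>p(x) = - \<integral>\<^sub>x\<^sup>l p'\<close> and exchanging the order of integration
  gives \<open>\<langle>A u, p\<rangle> = - \<integral> x\<^sup>\<alpha> u' p'\<close>. Hence \<open>\<langle>u(\<tau>), u(\<sigma> - \<tau>)\<rangle>\<close> is independent of \<open>\<tau>\<close>, so
  \<open>u(t) = 0\<close> implies \<open>u(3t/4) = 0\<close>. Iterating and letting time tend to \<open>0\<close> gives \<open>u\<^sub>0 = 0\<close>.
\<close>

section \<open>Square-integrable functions\<close>

text \<open>Functions are kept as functions, not classes, and the measure is arbitrary, so that
  Cauchy-Schwarz and the product rule in time are independent of the interval.
  \<open>L2_on_iff\<close> links this notion to \<open>L2_on\<close>.\<close>

definition sq_integrable :: "'a measure \<Rightarrow> ('a \<Rightarrow> real) \<Rightarrow> bool" where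
  "sq_integrable M f \<longleftrightarrow> f \<in> borel_measurable M \<and> integrable M (\<lambda>x. (f x)\<^sup>2)"

definition l2_norm :: "'a measure \<Rightarrow> ('a \<Rightarrow> real) \<Rightarrow> real" where
  "l2_norm M f = sqrt (\<integral>x. (f x)\<^sup>2 \<partial>M)"

lemma sq_integrable_measurable: "sq_integrable M f \<Longrightarrow> f \<in> borel_measurable M"
  by (simp add: sq_integrable_def)

lemma l2_norm_nonneg [simp]: "0 \<le> l2_norm M f"
  by (simp add: l2_norm_def)

lemma l2_norm_power2: "(l2_norm M f)\<^sup>2 = (\<integral>x. (f x)\<^sup>2 \<partial>M)"
  by (simp add: l2_norm_def)

lemma integrable_mult_sq_integrable:
  assumes "sq_integrable M f" "sq_integrable M g"
  shows "integrable M (\<lambda>x. f x * g x)"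
proof (rule Bochner_Integration.integrable_bound)
  show "integrable M (\<lambda>x. (f x)\<^sup>2 + (g x)\<^sup>2)"
    using assms by (auto simp: sq_integrable_def)
  show "(\<lambda>x. f x * g x) \<in> borel_measurable M"
    using assms by (auto simp: sq_integrable_def)
  have "\<bar>a * b\<bar> \<le> a\<^sup>2 + b\<^sup>2" for a b :: real
  proof -
    have "2 * (\<bar>a\<bar> * \<bar>b\<bar>) \<le> a\<^sup>2 + b\<^sup>2"
      using sum_squares_bound[of "\<bar>a\<bar>" "\<bar>b\<bar>"] by simp
    moreover have "0 \<le> \<bar>a\<bar> * \<bar>b\<bar>" by simp
    ultimately show ?thesis unfolding abs_mult by linarith
  qed
  then show "AE x in M. norm (f x * g x) \<le> norm ((f x)\<^sup>2 + (g x)\<^sup>2)"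
    by (auto simp: abs_of_nonneg)
qed

lemma sq_integrable_add:
  assumes "sq_integrable M f" "sq_integrable M g"
  shows "sq_integrable M (\<lambda>x. f x + g x)"
proof -
  have "integrable M (\<lambda>x. (f x)\<^sup>2 + (g x)\<^sup>2 + 2 * (f x * g x))"
    using assms integrable_mult_sq_integrable[OF assms]
    by (auto simp: sq_integrable_def)
  then show ?thesis
    using assms by (auto simp: sq_integrable_def power2_sum mult.assoc)
qed

lemma sq_integrable_cmult:
  "sq_integrable M f \<Longrightarrow> sq_integrable M (\<lambda>x. c * f x)"
  by (auto simp: sq_integrable_def power_mult_distrib)

lemma sq_integrable_diff:
  assumes "sq_integrable M f" "sq_integrable M g"
  shows "sq_integrable M (\<lambda>x. f x - g x)"
  using sq_integrable_add[OF assms(1) sq_integrable_cmult[OF assms(2), of "-1"]] by simp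

lemma sq_integrable_divide:
  "sq_integrable M f \<Longrightarrow> sq_integrable M (\<lambda>x. f x / c)"
  using sq_integrable_cmult[of M f "1 / c"] by simp

lemma l2_norm_cmult: "l2_norm M (\<lambda>x. c * f x) = \<bar>c\<bar> * l2_norm M f"
  by (simp add: l2_norm_def power_mult_distrib real_sqrt_mult)

text \<open>The integral of \<open>(s * f x + r * g x)\<^sup>2\<close> is a nonnegative quadratic
  form in \<open>s\<close> and \<open>r\<close>. Suitable values of both give the bound, with the
  degenerate case \<open>b = 0\<close> treated apart.\<close>

lemma l2_norm_Cauchy_Schwarz:
  assumes "sq_integrable M f" "sq_integrable M g"
  shows "\<bar>\<integral>x. f x * g x \<partial>M\<bar> \<le> l2_norm M f * l2_norm M g"
proof -
  define a where "a = l2_norm M f"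
  define b where "b = l2_norm M g"
  define d where "d = (\<integral>x. f x * g x \<partial>M)"
  have expand: "0 \<le> s\<^sup>2 * a\<^sup>2 + r\<^sup>2 * b\<^sup>2 + 2 * s * r * d" for s r
  proof -
    have "0 \<le> (\<integral>x. (s * f x + r * g x)\<^sup>2 \<partial>M)" by simp
    also have "(\<integral>x. (s * f x + r * g x)\<^sup>2 \<partial>M)
       = (\<integral>x. s\<^sup>2 * (f x)\<^sup>2 + r\<^sup>2 * (g x)\<^sup>2 + 2 * s * r * (f x * g x) \<partial>M)"
      by (rule Bochner_Integration.integral_cong) (auto simp: power2_eq_square algebra_simps)
    also have "\<dots> = s\<^sup>2 * a\<^sup>2 + r\<^sup>2 * b\<^sup>2 + 2 * s * r * d"
      using assms integrable_mult_sq_integrable[OF assms]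
      by (simp add: a_def b_def d_def l2_norm_power2 sq_integrable_def)
    finally show ?thesis .
  qed
  have ab: "0 \<le> a" "0 \<le> b" by (simp_all add: a_def b_def)
  have "\<bar>d\<bar> \<le> a * b"
  proof (cases "b = 0")
    case True
    show ?thesis
    proof (rule ccontr)
      assume "\<not> \<bar>d\<bar> \<le> a * b"
      then have "d \<noteq> 0" using True by simp
      \<comment> \<open>With \<open>b = 0\<close> the form is affine in \<open>r\<close> for
        \<open>s = 1\<close>; this \<open>r\<close> makes its value -1.\<close>
      have "0 \<le> a\<^sup>2 + 2 * (- (a\<^sup>2 + 1) / (2 * d)) * d"
        using expand[of 1 "- (a\<^sup>2 + 1) / (2 * d)"] True by simp
      then show False using \<open>d \<noteq> 0\<close> by (simp add: field_simps)
    qed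
  next
    case False
    then have "b > 0" using ab by simp
    \<comment> \<open>Taking \<open>s = b\<^sup>2\<close> and \<open>r = -d\<close> minimises the
      form up to scaling and leaves the discriminant times \<open>b\<^sup>2\<close>.\<close>
    have "0 \<le> b\<^sup>2 * (a\<^sup>2 * b\<^sup>2 - d\<^sup>2)"
      using expand[of "b\<^sup>2" "-d"] by (simp add: power2_eq_square algebra_simps)
    then have "d\<^sup>2 \<le> (a * b)\<^sup>2"
      using \<open>b > 0\<close> by (simp add: zero_le_mult_iff power_mult_distrib)
    then show ?thesis
      using ab by (metis abs_le_square_iff abs_of_nonneg mult_nonneg_nonneg)
  qed
  then show ?thesis by (simp add: a_def b_def d_def)
qed

lemma l2_norm_triangle:
  assumes "sq_integrable M f" "sq_integrable M g"
  shows "l2_norm M (\<lambda>x. f x + g x) \<le> l2_norm M f + l2_norm M g"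
proof (rule power2_le_imp_le)
  have "(l2_norm M (\<lambda>x. f x + g x))\<^sup>2 = (\<integral>x. (f x)\<^sup>2 + (g x)\<^sup>2 + 2 * (f x * g x) \<partial>M)"
    by (simp add: l2_norm_power2 power2_sum mult.assoc)
  also have "\<dots> = (l2_norm M f)\<^sup>2 + (l2_norm M g)\<^sup>2 + 2 * (\<integral>x. f x * g x \<partial>M)"
    using assms integrable_mult_sq_integrable[OF assms]
    by (simp add: l2_norm_power2 sq_integrable_def)
  also have "\<dots> \<le> (l2_norm M f + l2_norm M g)\<^sup>2"
    using l2_norm_Cauchy_Schwarz[OF assms] by (simp add: power2_sum)
  finally show "(l2_norm M (\<lambda>x. f x + g x))\<^sup>2 \<le> (l2_norm M f + l2_norm M g)\<^sup>2" .
qed simp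

lemma l2_norm_minus_commute: "l2_norm M (\<lambda>x. f x - g x) = l2_norm M (\<lambda>x. g x - f x)"
  by (simp add: l2_norm_def power2_commute)

lemma l2_norm_diff_triangle:
  assumes "sq_integrable M f" "sq_integrable M g" "sq_integrable M h"
  shows "l2_norm M (\<lambda>x. f x - h x) \<le> l2_norm M (\<lambda>x. f x - g x) + l2_norm M (\<lambda>x. g x - h x)"
  using l2_norm_triangle[OF sq_integrable_diff[OF assms(1,2)] sq_integrable_diff[OF assms(2,3)]]
  by simp

lemma l2_norm_eq_0_iff:
  assumes "sq_integrable M f"
  shows "l2_norm M f = 0 \<longleftrightarrow> (AE x in M. f x = 0)"
  using assms integral_nonneg_eq_0_iff_AE[of M "\<lambda>x. (f x)\<^sup>2"]
  by (simp add: l2_norm_def sq_integrable_def)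

section \<open>Limits and time derivatives of pairings in L2\<close>

lemma l2_limit_unique:
  assumes F: "F \<noteq> bot" and X: "\<forall>\<^sub>F s in F. sq_integrable M (X s)"
    and f: "sq_integrable M f" "((\<lambda>s. l2_norm M (\<lambda>x. X s x - f x)) \<longlongrightarrow> 0) F"
    and g: "sq_integrable M g" "((\<lambda>s. l2_norm M (\<lambda>x. X s x - g x)) \<longlongrightarrow> 0) F"
  shows "AE x in M. f x = g x"
proof -
  have "((\<lambda>s. l2_norm M (\<lambda>x. X s x - f x) + l2_norm M (\<lambda>x. X s x - g x)) \<longlongrightarrow> 0 + 0) F"
    by (intro tendsto_add f g)
  moreover have "\<forall>\<^sub>F s in F. l2_norm M (\<lambda>x. f x - g x)
      \<le> l2_norm M (\<lambda>x. X s x - f x) + l2_norm M (\<lambda>x. X s x - g x)"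
    using X
  proof eventually_elim
    case (elim s)
    show ?case
      using l2_norm_diff_triangle[OF f(1) elim g(1)] l2_norm_minus_commute[of M f "X s"] by simp
  qed
  ultimately have "l2_norm M (\<lambda>x. f x - g x) \<le> 0 + 0"
    by (intro tendsto_lowerbound[OF _ _ F]) auto
  then have "l2_norm M (\<lambda>x. f x - g x) = 0"
    by (smt (verit) l2_norm_nonneg)
  then show ?thesis
    using l2_norm_eq_0_iff[OF sq_integrable_diff[OF f(1) g(1)]] by simp
qed

text \<open>The difference of the products is
  \<open>(X - f) * (Y - g) + (X - f) * g + f * (Y - g)\<close>, and Cauchy-Schwarz sends the
  integral of each summand to 0.\<close>

lemma tendsto_l2_inner:
  assumes X: "\<forall>\<^sub>F s in F. sq_integrable M (X s)" and Y: "\<forall>\<^sub>F s in F. sq_integrable M (Y s)"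
    and f: "sq_integrable M f" "((\<lambda>s. l2_norm M (\<lambda>x. X s x - f x)) \<longlongrightarrow> 0) F"
    and g: "sq_integrable M g" "((\<lambda>s. l2_norm M (\<lambda>x. Y s x - g x)) \<longlongrightarrow> 0) F"
  shows "((\<lambda>s. \<integral>x. X s x * Y s x \<partial>M) \<longlongrightarrow> (\<integral>x. f x * g x \<partial>M)) F"
proof -
  let ?d = "\<lambda>s. l2_norm M (\<lambda>x. X s x - f x)" and ?e = "\<lambda>s. l2_norm M (\<lambda>x. Y s x - g x)"
  have "((\<lambda>s. ?d s * ?e s + ?d s * l2_norm M g + l2_norm M f * ?e s) \<longlongrightarrow>
      0 * 0 + 0 * l2_norm M g + l2_norm M f * 0) F"
    by (intro tendsto_intros f g)
  then have bound: "((\<lambda>s. ?d s * ?e s + ?d s * l2_norm M g + l2_norm M f * ?e s) \<longlongrightarrow> 0) F"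
    by simp
  have "\<forall>\<^sub>F s in F. norm ((\<integral>x. X s x * Y s x \<partial>M) - (\<integral>x. f x * g x \<partial>M))
      \<le> ?d s * ?e s + ?d s * l2_norm M g + l2_norm M f * ?e s"
    using X Y
  proof eventually_elim
    case (elim s)
    have d: "sq_integrable M (\<lambda>x. X s x - f x)" and e: "sq_integrable M (\<lambda>x. Y s x - g x)"
      using elim f g by (auto intro: sq_integrable_diff)
    note i = integrable_mult_sq_integrable[OF d e] integrable_mult_sq_integrable[OF d g(1)]
      integrable_mult_sq_integrable[OF f(1) e] integrable_mult_sq_integrable[OF f(1) g(1)]
    have "(\<integral>x. X s x * Y s x \<partial>M) = (\<integral>x. (X s x - f x) * (Y s x - g x) + (X s x - f x) * g x
        + f x * (Y s x - g x) + f x * g x \<partial>M)"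
      by (rule Bochner_Integration.integral_cong) (auto simp: algebra_simps)
    also have "\<dots> = (\<integral>x. (X s x - f x) * (Y s x - g x) \<partial>M) + (\<integral>x. (X s x - f x) * g x \<partial>M)
        + (\<integral>x. f x * (Y s x - g x) \<partial>M) + (\<integral>x. f x * g x \<partial>M)"
      using i by (simp only: Bochner_Integration.integral_add Bochner_Integration.integrable_add)
    finally show ?case
      using l2_norm_Cauchy_Schwarz[OF d e] l2_norm_Cauchy_Schwarz[OF d g(1)]
        l2_norm_Cauchy_Schwarz[OF f(1) e]
      by (simp add: abs_le_iff)
  qed
  then have "((\<lambda>s. (\<integral>x. X s x * Y s x \<partial>M) - (\<integral>x. f x * g x \<partial>M)) \<longlongrightarrow> 0) F"
    by (rule Lim_null_comparison[OF _ bound])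
  then show ?thesis by (simp add: LIM_zero_iff)
qed

text \<open>Product rule: the quotient of the pairing is the quotient of \<open>p\<close> paired
  with \<open>q s\<close> plus \<open>p t\<close> paired with the quotient of \<open>q\<close>. Both
  pairings converge by \<open>tendsto_l2_inner\<close>.\<close>

lemma has_real_derivative_l2_inner:
  assumes p: "\<And>s. s \<in> S \<Longrightarrow> sq_integrable M (p s)" and q: "\<And>s. s \<in> S \<Longrightarrow> sq_integrable M (q s)"
    and t: "t \<in> S" and p': "sq_integrable M p'" and q': "sq_integrable M q'"
    and dp: "((\<lambda>s. l2_norm M (\<lambda>x. (p s x - p t x) / (s - t) - p' x)) \<longlongrightarrow> 0) (at t within S)"
    and dq: "((\<lambda>s. l2_norm M (\<lambda>x. (q s x - q t x) / (s - t) - q' x)) \<longlongrightarrow> 0) (at t within S)"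
  shows "((\<lambda>s. \<integral>x. p s x * q s x \<partial>M) has_real_derivative
           (\<integral>x. p' x * q t x \<partial>M) + (\<integral>x. p t x * q' x \<partial>M)) (at t within S)"
proof -
  let ?F = "at t within S"
  have ev: "\<forall>\<^sub>F s in ?F. s \<in> S \<and> s \<noteq> t" by (auto simp: eventually_at_filter)
  have Dp: "\<forall>\<^sub>F s in ?F. sq_integrable M (\<lambda>x. (p s x - p t x) / (s - t))"
    using ev by eventually_elim (auto intro!: sq_integrable_divide sq_integrable_diff p t)
  have Dq: "\<forall>\<^sub>F s in ?F. sq_integrable M (\<lambda>x. (q s x - q t x) / (s - t))"
    using ev by eventually_elim (auto intro!: sq_integrable_divide sq_integrable_diff q t)
  have q_ev: "\<forall>\<^sub>F s in ?F. sq_integrable M (q s)" using ev by eventually_elim (auto intro: q)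
  \<comment> \<open>Differentiability implies continuity: the increment of \<open>q\<close> is
    \<open>\<bar>s - t\<bar>\<close> times a quotient whose norm stays bounded. This gives the limit
    of the factor \<open>q s\<close> in the first pairing.\<close>
  have cont: "((\<lambda>s. l2_norm M (\<lambda>x. q s x - q t x)) \<longlongrightarrow> 0) ?F"
  proof (rule Lim_null_comparison)
    have "((\<lambda>s. \<bar>s - t\<bar> * (l2_norm M (\<lambda>x. (q s x - q t x) / (s - t) - q' x) + l2_norm M q'))
        \<longlongrightarrow> \<bar>t - t\<bar> * (0 + l2_norm M q')) ?F"
      by (intro tendsto_intros dq)
    then show "((\<lambda>s. \<bar>s - t\<bar> * (l2_norm M (\<lambda>x. (q s x - q t x) / (s - t) - q' x) + l2_norm M q'))
        \<longlongrightarrow> 0) ?F"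
      by simp
    show "\<forall>\<^sub>F s in ?F. norm (l2_norm M (\<lambda>x. q s x - q t x))
        \<le> \<bar>s - t\<bar> * (l2_norm M (\<lambda>x. (q s x - q t x) / (s - t) - q' x) + l2_norm M q')"
      using ev Dq
    proof eventually_elim
      case (elim s)
      have "l2_norm M (\<lambda>x. q s x - q t x) = \<bar>s - t\<bar> * l2_norm M (\<lambda>x. (q s x - q t x) / (s - t))"
        using elim by (subst l2_norm_cmult[symmetric]) simp
      moreover have "l2_norm M (\<lambda>x. (q s x - q t x) / (s - t))
          \<le> l2_norm M (\<lambda>x. (q s x - q t x) / (s - t) - q' x) + l2_norm M q'"
        using l2_norm_triangle[OF sq_integrable_diff[OF elim(2) q'] q'] by simp
      ultimately show ?case by (simp add: mult_left_mono)
    qed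
  qed
  have "((\<lambda>s. (\<integral>x. ((p s x - p t x) / (s - t)) * q s x \<partial>M)
        + (\<integral>x. p t x * ((q s x - q t x) / (s - t)) \<partial>M)) \<longlongrightarrow>
      (\<integral>x. p' x * q t x \<partial>M) + (\<integral>x. p t x * q' x \<partial>M)) ?F"
    by (intro tendsto_add tendsto_l2_inner[where F="?F"])
      (use Dp Dq q_ev p' q' dp dq cont p[OF t] q[OF t] in \<open>auto simp: l2_norm_def\<close>)
  moreover have "\<forall>\<^sub>F s in ?F. (\<integral>x. ((p s x - p t x) / (s - t)) * q s x \<partial>M)
        + (\<integral>x. p t x * ((q s x - q t x) / (s - t)) \<partial>M)
      = ((\<integral>x. p s x * q s x \<partial>M) - (\<integral>x. p t x * q t x \<partial>M)) / (s - t)"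
    using ev Dp Dq
  proof eventually_elim
    case (elim s)
    then have st: "s \<in> S" "s \<noteq> t" by auto
    have "(\<integral>x. ((p s x - p t x) / (s - t)) * q s x \<partial>M)
        + (\<integral>x. p t x * ((q s x - q t x) / (s - t)) \<partial>M)
      = (\<integral>x. ((p s x - p t x) / (s - t)) * q s x + p t x * ((q s x - q t x) / (s - t)) \<partial>M)"
      by (intro Bochner_Integration.integral_add[symmetric] integrable_mult_sq_integrable
          elim p q t st)
    also have "\<dots> = (\<integral>x. (p s x * q s x - p t x * q t x) / (s - t) \<partial>M)"
      using st by (intro Bochner_Integration.integral_cong) (auto simp: add_divide_distrib diff_divide_distrib algebra_simps)
    also have "\<dots> = ((\<integral>x. p s x * q s x \<partial>M) - (\<integral>x. p t x * q t x \<partial>M)) / (s - t)"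
      using integrable_mult_sq_integrable[OF p q] st t by simp
    finally show ?case .
  qed
  ultimately show ?thesis
    unfolding has_field_derivative_iff by (rule Lim_transform_eventually)
qed

section \<open>Weak derivatives\<close>

abbreviation ivl :: "real \<Rightarrow> real measure" where
  "ivl l \<equiv> restrict_space lborel {0<..<l}"

lemma finite_measure_ivl: "finite_measure (ivl l)"
  by (rule finite_measureI)
    (cases "0 \<le> l"; simp add: space_restrict_space emeasure_restrict_space)

lemma set_integrable_ivl: "set_integrable lborel {0<..<l} f \<longleftrightarrow> integrable (ivl l) f" for f :: "real \<Rightarrow> real"
  by (simp add: set_integrable_eq)

lemma set_integral_ivl: "(LBINT x:{0<..<l}. f x) = (\<integral>x. f x \<partial>ivl l)" for f :: "real \<Rightarrow> real"
  by (simp add: set_lebesgue_integral_def integral_restrict_space)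

lemma AE_ivl: "(AE x in lborel. x \<in> {0<..<l} \<longrightarrow> P x) \<longleftrightarrow> (AE x in ivl l. P x)"
  by (simp add: AE_restrict_space_iff)

lemma borel_measurable_ivl: "f \<in> borel_measurable borel \<Longrightarrow> f \<in> borel_measurable (ivl l)"
  by (simp add: measurable_restrict_space1)

text \<open>The interval has finite measure, so the constant 1 is square integrable and pairing with
  it yields the plain integrability demanded by \<open>L2_on\<close>.\<close>

lemma L2_on_iff: "L2_on l f \<longleftrightarrow> sq_integrable (ivl l) f"
proof -
  interpret finite_measure "ivl l" by (rule finite_measure_ivl)
  have "integrable (ivl l) f" if "sq_integrable (ivl l) f"
  proof -
    have "sq_integrable (ivl l) (\<lambda>_. 1)" by (simp add: sq_integrable_def)
    from integrable_mult_sq_integrable[OF that this] show ?thesis by simp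
  qed
  moreover have "sq_integrable (ivl l) f" if "L2_on l f"
    using that unfolding L2_on_def set_integrable_ivl sq_integrable_def
    by (blast intro: borel_measurable_integrable)
  ultimately show ?thesis
    unfolding L2_on_def set_integrable_ivl by (metis sq_integrable_def)
qed

lemma sq_integrable_ivl_integrable: "sq_integrable (ivl l) f \<Longrightarrow> integrable (ivl l) f"
  using L2_on_iff[of l f] by (simp add: L2_on_def set_integrable_ivl)

lemma L2_dist_eq: "L2_dist l f g = l2_norm (ivl l) (\<lambda>x. f x - g x)"
  by (simp add: L2_dist_def l2_norm_def set_integral_ivl)

lemma ae_eq_on_iff: "ae_eq_on l f g \<longleftrightarrow> (AE x in ivl l. f x = g x)"
  by (simp add: ae_eq_on_def AE_restrict_space_iff)

lemma ennreal_mult_indicator: "ennreal (a * indicator A x) = ennreal a * indicator A x"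
  by (simp add: indicator_def)

text \<open>The positive and negative parts of \<open>f\<close> are densities of two measures that
  are finite and equal on all rays \<open>{x<..}\<close>. The measures therefore coincide, and
  uniqueness of densities makes both parts equal almost everywhere.\<close>

lemma AE_zero_if_integrals_zero:
  fixes f :: "real \<Rightarrow> real"
  assumes f: "integrable lborel f" and zero: "\<And>x. (\<integral>y. f y * indicator {x<..} y \<partial>lborel) = 0"
  shows "AE x in lborel. f x = 0"
proof -
  have fm[measurable]: "f \<in> borel_measurable borel" using f by auto
  let ?p = "\<lambda>x. ennreal (max 0 (f x))" and ?n = "\<lambda>x. ennreal (max 0 (- f x))"
  have pi: "integrable lborel (\<lambda>y. max 0 (f y) * indicator {x<..} y)" for x
    by (rule Bochner_Integration.integrable_bound[OF f]) (auto simp: indicator_def)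
  have ni: "integrable lborel (\<lambda>y. max 0 (- f y) * indicator {x<..} y)" for x
    by (rule Bochner_Integration.integrable_bound[OF f]) (auto simp: indicator_def)
  have e: "emeasure (density lborel ?p) {x<..} = ennreal (\<integral>y. max 0 (f y) * indicator {x<..} y \<partial>lborel)"
    "emeasure (density lborel ?n) {x<..} = ennreal (\<integral>y. max 0 (- f y) * indicator {x<..} y \<partial>lborel)" for x
    using nn_integral_eq_integral[OF pi[of x]] nn_integral_eq_integral[OF ni[of x]]
    by (simp_all add: emeasure_density ennreal_mult_indicator)
  have "density lborel ?p = density lborel ?n"
  proof (rule measure_eqI_lessThan)
    fix x
    show "emeasure (density lborel ?p) {x<..} < \<infinity>" by (simp add: e)
    have "(\<integral>y. max 0 (f y) * indicator {x<..} y \<partial>lborel) - (\<integral>y. max 0 (- f y) * indicator {x<..} y \<partial>lborel)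
        = (\<integral>y. max 0 (f y) * indicator {x<..} y - max 0 (- f y) * indicator {x<..} y \<partial>lborel)"
      using pi ni by simp
    also have "\<dots> = (\<integral>y. f y * indicator {x<..} y \<partial>lborel)"
      by (rule Bochner_Integration.integral_cong) (auto simp: indicator_def max_def)
    finally show "emeasure (density lborel ?p) {x<..} = emeasure (density lborel ?n) {x<..}"
      using zero[of x] by (simp add: e)
  qed simp_all
  then have "AE x in lborel. ?p x = ?n x"
    by (subst (asm) sigma_finite_measure.density_unique_iff[OF sigma_finite_lborel]) auto
  then show ?thesis
    by eventually_elim (auto simp: max_def split: if_splits)
qed

section \<open>Test functions and the weak formulation\<close>

definition test_fun :: "real \<Rightarrow> (real \<Rightarrow> real) \<Rightarrow> bool" where
  "test_fun l \<phi> \<longleftrightarrow> \<phi> C1_differentiable_on UNIV \<and>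
     (\<exists>a b. 0 < a \<and> a \<le> b \<and> b < l \<and> (\<forall>x. x \<notin> {a..b} \<longrightarrow> \<phi> x = 0))"

definition locally_integrable :: "real \<Rightarrow> (real \<Rightarrow> real) \<Rightarrow> bool" where
  "locally_integrable l f \<longleftrightarrow>
     (\<forall>a b. 0 < a \<longrightarrow> a \<le> b \<longrightarrow> b < l \<longrightarrow> set_integrable lborel {a..b} f)"

lemma weak_deriv_iff:
  "weak_deriv l f g \<longleftrightarrow> locally_integrable l f \<and> locally_integrable l g \<and>
     (\<forall>\<phi>. test_fun l \<phi> \<longrightarrow> (\<integral>x. f x * deriv \<phi> x \<partial>ivl l) = - (\<integral>x. g x * \<phi> x \<partial>ivl l))"
proof -
  have "weak_deriv l f g \<longleftrightarrow>
     (\<forall>a b. 0 < a \<longrightarrow> a \<le> b \<longrightarrow> b < l \<longrightarrow>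
        set_integrable lborel {a..b} f \<and> set_integrable lborel {a..b} g) \<and>
     (\<forall>\<phi>. test_fun l \<phi> \<longrightarrow> (\<integral>x. f x * deriv \<phi> x \<partial>ivl l) = - (\<integral>x. g x * \<phi> x \<partial>ivl l))"
    unfolding weak_deriv_def test_fun_def set_integral_ivl imp_conjL ..
  then show ?thesis unfolding locally_integrable_def by (simp only:) blast
qed

lemma C1_differentiable_on_UNIV_I:
  fixes f :: "real \<Rightarrow> real"
  assumes "\<And>x. (f has_real_derivative f' x) (at x)" "continuous_on UNIV f'"
  shows "f C1_differentiable_on UNIV"
  unfolding C1_differentiable_on_def
  using assms by (auto simp: has_real_derivative_iff_has_vector_derivative)

lemma C1_differentiable_on_UNIV_D:
  fixes f :: "real \<Rightarrow> real"
  assumes "f C1_differentiable_on UNIV"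
  shows "(f has_real_derivative deriv f x) (at x)" "continuous_on UNIV (deriv f)"
proof -
  obtain D where D: "\<And>x. (f has_real_derivative D x) (at x)" "continuous_on UNIV D"
    using assms by (auto simp: C1_differentiable_on_def has_real_derivative_iff_has_vector_derivative)
  have "deriv f = D" using D(1) by (auto intro!: ext DERIV_imp_deriv)
  then show "(f has_real_derivative deriv f x) (at x)" "continuous_on UNIV (deriv f)"
    using D by auto
qed

lemma test_fun_continuous: "test_fun l \<phi> \<Longrightarrow> continuous_on UNIV \<phi>"
  by (rule continuous_at_imp_continuous_on)
    (simp add: test_fun_def DERIV_isCont[OF C1_differentiable_on_UNIV_D(1)])

text \<open>The continuous factor is bounded on its compact support, so the product is dominated by
  a multiple of \<open>f\<close> there.\<close>

lemma integrable_locally_mult_compact: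
  assumes f: "locally_integrable l f" and g: "continuous_on UNIV g"
    and ab: "0 < a" "a \<le> b" "b < l" and supp: "\<And>x. x \<notin> {a..b} \<Longrightarrow> g x = 0"
  shows "integrable (ivl l) (\<lambda>x. f x * g x)"
proof -
  have "bounded (g ` {a..b})"
    using g by (intro compact_imp_bounded compact_continuous_image) (auto intro: continuous_on_subset)
  then obtain B where B: "\<forall>x\<in>{a..b}. \<bar>g x\<bar> \<le> B"
    by (auto simp: bounded_iff)
  have [measurable]: "g \<in> borel_measurable borel"
    using g by (rule borel_measurable_continuous_onI)
  have fi: "integrable lborel (\<lambda>x. indicator {a..b} x * f x)"
    using f ab by (auto simp: locally_integrable_def set_integrable_def)
  then have [measurable]: "(\<lambda>x. indicator {a..b} x * f x) \<in> borel_measurable borel"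
    by auto
  have "integrable lborel (\<lambda>x. indicator {a..b} x * f x * g x)"
  proof (rule Bochner_Integration.integrable_bound)
    show "integrable lborel (\<lambda>x. B * (indicator {a..b} x * f x))" using fi by simp
    show "AE x in lborel. norm (indicator {a..b} x * f x * g x) \<le> norm (B * (indicator {a..b} x * f x))"
    proof (rule AE_I2)
      fix x
      show "norm (indicator {a..b} x * f x * g x) \<le> norm (B * (indicator {a..b} x * f x))"
        using B abs_ge_self[of B] by (cases "x \<in> {a..b}")
          (force simp: abs_mult mult.commute[of B] intro!: mult_left_mono)+
    qed
  qed simp
  also have "(\<lambda>x. indicator {a..b} x * f x * g x) = (\<lambda>x. indicator {0<..<l} x *\<^sub>R (f x * g x))"
    using ab supp by (auto simp: indicator_def fun_eq_iff)
  finally show ?thesis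
    by (simp add: integrable_restrict_space)
qed

section \<open>C1 cutoffs approximating the indicator of an interval\<close>

definition bump :: "real \<Rightarrow> real \<Rightarrow> real \<Rightarrow> real" where
  "bump a b x = (max 0 ((x - a) * (b - x)))\<^sup>2"

text \<open>Squaring removes the corner of the positive part: at 0 the difference quotient is at
  most \<open>\<bar>h\<bar>\<close>. This is what makes \<open>bump\<close> a C1 function.\<close>

lemma has_real_derivative_max0_power2:
  "((\<lambda>y::real. (max 0 y)\<^sup>2) has_real_derivative 2 * max 0 y) (at y)"
proof (cases "y = 0")
  case True
  have "((\<lambda>h::real. (max 0 h)\<^sup>2 / h) \<longlongrightarrow> 0) (at 0)"
  proof (rule Lim_null_comparison)
    show "((\<lambda>h::real. \<bar>h\<bar>) \<longlongrightarrow> 0) (at 0)" using tendsto_rabs[OF tendsto_ident_at, of 0] by simp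
    show "\<forall>\<^sub>F h::real in at 0. norm ((max 0 h)\<^sup>2 / h) \<le> \<bar>h\<bar>"
      by (rule always_eventually) (auto simp: max_def power2_eq_square)
  qed
  then show ?thesis using True by (simp add: has_field_derivative_iff)
next
  case False
  show ?thesis
  proof (cases "y > 0")
    case True
    have "((\<lambda>y::real. y\<^sup>2) has_real_derivative 2 * max 0 y) (at y)"
      using True by (auto intro!: derivative_eq_intros)
    then show ?thesis
      by (rule DERIV_cong_ev[THEN iffD1, rotated -1, OF _ refl _ refl])
        (use eventually_nhds_in_open[of "{0<..}" y] True in \<open>auto elim!: eventually_mono\<close>)
  next
    case False
    then have "y < 0" using \<open>y \<noteq> 0\<close> by simp
    have "((\<lambda>y::real. 0) has_real_derivative 2 * max 0 y) (at y)"
      using \<open>y < 0\<close> by (auto intro!: derivative_eq_intros)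
    then show ?thesis
      by (rule DERIV_cong_ev[THEN iffD1, rotated -1, OF _ refl _ refl])
        (use eventually_nhds_in_open[of "{..<0}" y] \<open>y < 0\<close> in \<open>auto elim!: eventually_mono\<close>)
  qed
qed

text \<open>The map t / (1 + t) sends the nonnegative reals into [0, 1) and fixes 0. Applied to
  \<open>n * bump\<close>, it gives C1 functions that vanish where \<open>bump\<close> does and tend
  to 1 wherever \<open>bump\<close> is positive.\<close>

definition cutoff :: "real \<Rightarrow> real \<Rightarrow> nat \<Rightarrow> real \<Rightarrow> real" where
  "cutoff a b n x = real n * bump a b x / (1 + real n * bump a b x)"

lemma cutoff_range: "0 \<le> cutoff a b n x" "cutoff a b n x \<le> 1"
proof -
  have "0 \<le> real n * bump a b x" by (simp add: bump_def)
  then show "0 \<le> cutoff a b n x" "cutoff a b n x \<le> 1" by (simp_all add: cutoff_def)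
qed

lemma cutoff_eq_0: "a \<le> b \<Longrightarrow> x \<notin> {a<..<b} \<Longrightarrow> cutoff a b n x = 0"
proof -
  assume "a \<le> b" "x \<notin> {a<..<b}"
  then have "(x - a) * (b - x) \<le> 0" by (auto simp: mult_le_0_iff)
  then show ?thesis by (simp add: cutoff_def bump_def max_def)
qed

lemma cutoff_tendsto: "x \<in> {a<..<b} \<Longrightarrow> (\<lambda>n. cutoff a b n x) \<longlonglongrightarrow> 1"
proof -
  assume x: "x \<in> {a<..<b}"
  define c where "c = bump a b x"
  have "0 < (x - a) * (b - x)" using x by simp
  then have "max 0 ((x - a) * (b - x)) > 0" by linarith
  then have c: "c > 0" unfolding c_def bump_def by (rule zero_less_power)
  have lim: "(\<lambda>n. 1 - 1 / (1 + real n * c)) \<longlonglongrightarrow> 1 - 0"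
  proof (intro tendsto_diff tendsto_const tendsto_divide_0 filterlim_at_top_imp_at_infinity)
    show "filterlim (\<lambda>n. 1 + real n * c) at_top sequentially"
      by (intro filterlim_tendsto_add_at_top[OF tendsto_const]
          filterlim_at_top_mult_tendsto_pos[OF tendsto_const c filterlim_real_sequentially])
  qed (rule tendsto_const)
  have "1 + real n * c > 0" for n using c by (simp add: add_pos_nonneg)
  then have "1 + real n * c \<noteq> 0" for n by (metis less_irrefl)
  then have "1 - 1 / (1 + real n * c) = cutoff a b n x" for n
    by (simp add: cutoff_def c_def[symmetric] diff_divide_eq_iff)
  then show ?thesis using lim by simp
qed

lemma test_fun_cutoff:
  assumes "0 < a" "a \<le> b" "b < l"
  shows "test_fun l (cutoff a b n)"
proof -
  let ?P = "\<lambda>x. (x - a) * (b - x)"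
  define d where "d x = 2 * max 0 (?P x) * (a + b - 2 * x)" for x
  have bd: "(bump a b has_real_derivative d x) (at x)" for x
  proof -
    have "(?P has_real_derivative (a + b - 2 * x)) (at x)"
      by (auto intro!: derivative_eq_intros)
    from DERIV_chain2[OF has_real_derivative_max0_power2 this]
    show ?thesis by (simp add: bump_def[abs_def] d_def)
  qed
  have pos: "1 + real n * bump a b x > 0" for x
    by (simp add: bump_def add_pos_nonneg)
  then have nz: "1 + real n * bump a b x \<noteq> 0" for x
    by (metis less_irrefl)
  have "cutoff a b n C1_differentiable_on UNIV"
  proof (rule C1_differentiable_on_UNIV_I)
    show "(cutoff a b n has_real_derivative
        real n * d x / (1 + real n * bump a b x)\<^sup>2) (at x)" for x
      unfolding cutoff_def[abs_def]
      by (rule DERIV_cong[OF DERIV_divide[OF DERIV_cmult[OF bd]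
              DERIV_add[OF DERIV_const DERIV_cmult[OF bd]] nz]])
        (simp add: power2_eq_square algebra_simps)
    show "continuous_on UNIV (\<lambda>x. real n * d x / (1 + real n * bump a b x)\<^sup>2)"
      unfolding d_def bump_def using nz by (intro continuous_intros) (auto simp: bump_def)
  qed
  moreover have "\<forall>x. x \<notin> {a..b} \<longrightarrow> cutoff a b n x = 0"
    using assms by (auto intro!: cutoff_eq_0)
  ultimately show ?thesis
    using assms unfolding test_fun_def by blast
qed

text \<open>The fundamental lemma of the calculus of variations. Cutoffs and dominated convergence
  give vanishing integrals over all compactly contained intervals;
  \<open>AE_zero_if_integrals_zero\<close> then applies on each of them, and countably many exhaust
  (0, l).\<close>

lemma AE_zero_if_test_integrals_zero:
  assumes g: "locally_integrable l g" and l: "0 < l"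
    and zero: "\<And>\<phi>. test_fun l \<phi> \<Longrightarrow> (\<integral>x. g x * \<phi> x \<partial>ivl l) = 0"
  shows "AE x in ivl l. g x = 0"
proof -
  have int0: "(\<integral>x. indicator {a<..<b} x * g x \<partial>lborel) = 0" if ab: "0 < a" "a \<le> b" "b < l" for a b
  proof -
    have gi: "integrable lborel (\<lambda>x. indicator {a..b} x * g x)"
      using g ab by (auto simp: locally_integrable_def set_integrable_def)
    have m[measurable]: "(\<lambda>x. indicator {a..b} x * g x) \<in> borel_measurable borel"
      using gi by auto
    have cm[measurable]: "cutoff a b n \<in> borel_measurable borel" for n
      using test_fun_continuous[OF test_fun_cutoff[OF ab]] by (rule borel_measurable_continuous_onI)
    have "(\<lambda>n. \<integral>x. (indicator {a..b} x * g x) * cutoff a b n x \<partial>lborel) \<longlonglongrightarrow>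
        (\<integral>x. (indicator {a..b} x * g x) * indicator {a<..<b} x \<partial>lborel)"
    proof (rule integral_dominated_convergence[where w="\<lambda>x. norm (indicator {a..b} x * g x)"])
      show "integrable lborel (\<lambda>x. norm (indicator {a..b} x * g x))" using gi by (rule integrable_norm)
      show "AE x in lborel. (\<lambda>n. indicator {a..b} x * g x * cutoff a b n x)
          \<longlonglongrightarrow> indicator {a..b} x * g x * indicator {a<..<b} x"
      proof (rule AE_I2)
        fix x
        have "(\<lambda>n. cutoff a b n x) \<longlonglongrightarrow> indicator {a<..<b} x"
          using cutoff_tendsto[of x a b] cutoff_eq_0[OF ab(2), of x] by (cases "x \<in> {a<..<b}") auto
        then show "(\<lambda>n. indicator {a..b} x * g x * cutoff a b n x)
          \<longlonglongrightarrow> indicator {a..b} x * g x * indicator {a<..<b} x"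
          by (intro tendsto_mult tendsto_const)
      qed
      show "AE x in lborel. norm (indicator {a..b} x * g x * cutoff a b n x)
          \<le> norm (indicator {a..b} x * g x)" for n
        using cutoff_range[of a b n]
        by (intro AE_I2) (auto simp: abs_mult intro!: mult_right_le_one_le)
    qed measurable
    moreover have "(\<integral>x. (indicator {a..b} x * g x) * cutoff a b n x \<partial>lborel) = 0" for n
    proof -
      have "(\<integral>x. (indicator {a..b} x * g x) * cutoff a b n x \<partial>lborel)
          = (\<integral>x. indicator {0<..<l} x *\<^sub>R (g x * cutoff a b n x) \<partial>lborel)"
        using ab cutoff_eq_0[OF ab(2), of _ n]
        by (intro Bochner_Integration.integral_cong)
          (simp_all add: indicator_def, smt (verit))
      also have "\<dots> = 0"
        using zero[OF test_fun_cutoff[OF ab]] by (simp add: integral_restrict_space)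
      finally show ?thesis .
    qed
    ultimately have "(\<integral>x. (indicator {a..b} x * g x) * indicator {a<..<b} x \<partial>lborel) = 0"
      using LIMSEQ_unique[OF _ tendsto_const] by simp
    also have "(\<lambda>x. (indicator {a..b} x * g x) * indicator {a<..<b} x) = (\<lambda>x. indicator {a<..<b} x * g x)"
      by (auto simp: indicator_def fun_eq_iff)
    finally show ?thesis .
  qed
  have local: "AE x in lborel. x \<in> {a<..<b} \<longrightarrow> g x = 0" if ab: "0 < a" "a \<le> b" "b < l" for a b
  proof -
    have "integrable lborel (\<lambda>x. indicator {a<..<b} x * (indicator {a..b} x * g x))"
      using g ab integrable_mult_indicator[of "{a<..<b}" lborel "\<lambda>x. indicator {a..b} x * g x"]
      by (auto simp: locally_integrable_def set_integrable_def)
    also have "(\<lambda>x. indicator {a<..<b} x * (indicator {a..b} x * g x)) = (\<lambda>x. indicator {a<..<b} x * g x)"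
      by (auto simp: indicator_def fun_eq_iff)
    finally have "integrable lborel (\<lambda>x. indicator {a<..<b} x * g x)" .
    then have "AE x in lborel. indicator {a<..<b} x * g x = 0"
    proof (rule AE_zero_if_integrals_zero)
      fix x
      \<comment> \<open>A ray cuts the interval in another interval. Clamping its left end into
        [a, b] keeps \<open>int0\<close> applicable when \<open>x\<close> lies outside; for
        \<open>x\<close> beyond \<open>b\<close> the interval is empty.\<close>
      have "(\<lambda>y. indicator {a<..<b} y * g y * indicator {x<..} y)
          = (\<lambda>y. indicator {min b (max a x)<..<b} y * g y)"
        by (auto simp: indicator_def fun_eq_iff min_def max_def)
      then show "(\<integral>y. indicator {a<..<b} y * g y * indicator {x<..} y \<partial>lborel) = 0"
        using int0[of "min b (max a x)" b] ab by auto
    qed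
    then show ?thesis by eventually_elim (auto simp: indicator_def split: if_splits)
  qed
  \<comment> \<open>The offset 3 gives \<open>?a n \<le> l / 3\<close>, so that
    \<open>?a n \<le> l - ?a n\<close> already for \<open>n = 0\<close>.\<close>
  let ?a = "\<lambda>n::nat. l / (3 + real n)"
  have "AE x in lborel. \<forall>n. x \<in> {?a n<..<l - ?a n} \<longrightarrow> g x = 0"
    unfolding AE_all_countable
  proof
    fix n
    have "?a n \<le> l / 3" using l by (intro divide_left_mono) auto
    then show "AE x in lborel. x \<in> {?a n<..<l - ?a n} \<longrightarrow> g x = 0"
      using l by (intro local) auto
  qed
  then have "AE x in lborel. x \<in> {0<..<l} \<longrightarrow> g x = 0"
  proof eventually_elim
    case (elim x)
    show ?case
    proof
      assume x: "x \<in> {0<..<l}"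
      have "?a \<longlonglongrightarrow> 0"
        by (rule tendsto_divide_0[OF tendsto_const filterlim_at_top_imp_at_infinity[OF
              filterlim_tendsto_add_at_top[OF tendsto_const filterlim_real_sequentially]]])
      then have "\<forall>\<^sub>F n in sequentially. ?a n < min x (l - x)"
        using x by (intro order_tendstoD) auto
      then obtain n where "?a n < min x (l - x)"
        by (auto simp: eventually_sequentially)
      then have "x \<in> {?a n<..<l - ?a n}" by auto
      then show "g x = 0" using elim by blast
    qed
  qed
  then show ?thesis by (simp only: AE_ivl)
qed

text \<open>The derivative vanishes off \<open>{a..b}\<close> because the complement is open, so the
  test function is locally zero there.\<close>

lemma test_funE:
  assumes "test_fun l \<phi>"
  obtains a b where "0 < a" "a \<le> b" "b < l" "\<And>x. x \<notin> {a..b} \<Longrightarrow> \<phi> x = 0"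
    "\<And>x. x \<notin> {a..b} \<Longrightarrow> deriv \<phi> x = 0" "\<And>x. (\<phi> has_real_derivative deriv \<phi> x) (at x)"
    "continuous_on UNIV \<phi>" "continuous_on UNIV (deriv \<phi>)"
proof -
  obtain a b where ab: "0 < a" "a \<le> b" "b < l" "\<And>x. x \<notin> {a..b} \<Longrightarrow> \<phi> x = 0"
    and C1: "\<phi> C1_differentiable_on UNIV"
    using assms unfolding test_fun_def by blast
  note D = C1_differentiable_on_UNIV_D[OF C1]
  have "deriv \<phi> x = 0" if "x \<notin> {a..b}" for x
  proof -
    have "\<forall>\<^sub>F y in nhds x. y \<in> - {a..b}"
      using that by (intro eventually_nhds_in_open) auto
    then have "\<forall>\<^sub>F y in nhds x. \<phi> y = 0"
      by eventually_elim (use ab in auto)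
    then have "(\<phi> has_real_derivative 0) (at x)"
      by (subst DERIV_cong_ev[OF refl _ refl]) auto
    then show ?thesis by (rule DERIV_imp_deriv)
  qed
  then show ?thesis
    using that ab D test_fun_continuous[OF assms] by blast
qed

lemma test_fun_diff_cmult:
  assumes "test_fun l \<phi>" "test_fun l \<psi>"
  shows "test_fun l (\<lambda>x. \<phi> x - k * \<psi> x)"
proof -
  obtain a b where ab: "0 < a" "a \<le> b" "b < l" "\<And>x. x \<notin> {a..b} \<Longrightarrow> \<phi> x = 0"
    using assms(1) unfolding test_fun_def by blast
  obtain a' b' where ab': "0 < a'" "a' \<le> b'" "b' < l" "\<And>x. x \<notin> {a'..b'} \<Longrightarrow> \<psi> x = 0"
    using assms(2) unfolding test_fun_def by blast
  have "(\<lambda>x. \<phi> x - k * \<psi> x) C1_differentiable_on UNIV"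
    using assms unfolding test_fun_def
    by (intro C1_differentiable_on_diff C1_differentiable_on_mult C1_differentiable_on_const) auto
  moreover have "\<forall>x. x \<notin> {min a a'..max b b'} \<longrightarrow> \<phi> x - k * \<psi> x = 0"
  proof (intro allI impI)
    fix x assume "x \<notin> {min a a'..max b b'}"
    then have "x \<notin> {a..b}" "x \<notin> {a'..b'}" by auto
    then show "\<phi> x - k * \<psi> x = 0" using ab(4) ab'(4) by simp
  qed
  ultimately show ?thesis
    unfolding test_fun_def using ab ab'
    by (intro conjI exI[of _ "min a a'"] exI[of _ "max b b'"]) auto
qed

section \<open>Uniqueness of weak derivatives and the du Bois-Reymond lemma\<close>

lemma locally_integrable_diff:
  "locally_integrable l f \<Longrightarrow> locally_integrable l g \<Longrightarrow> locally_integrable l (\<lambda>x. f x - g x)"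
  by (simp add: locally_integrable_def set_integral_diff(1))

lemma integrable_imp_locally_integrable:
  "integrable (ivl l) f \<Longrightarrow> locally_integrable l f"
  unfolding locally_integrable_def set_integrable_ivl[symmetric]
  by (auto intro!: set_integrable_subset[of lborel "{0<..<l}" f])

lemma locally_integrable_const: "locally_integrable l (\<lambda>_. c)"
  using finite_measure.integrable_const[OF finite_measure_ivl]
  by (rule integrable_imp_locally_integrable)

lemma integrable_mult_test_fun:
  assumes f: "locally_integrable l f" and \<phi>: "test_fun l \<phi>"
  shows "integrable (ivl l) (\<lambda>x. f x * \<phi> x)" "integrable (ivl l) (\<lambda>x. f x * deriv \<phi> x)"
  using \<phi> by (auto elim!: test_funE intro!: integrable_locally_mult_compact[OF f])

lemma weak_deriv_unique:
  assumes "weak_deriv l f g" "weak_deriv l f h" "0 < l"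
  shows "AE x in ivl l. g x = h x"
proof -
  have g: "locally_integrable l g" and h: "locally_integrable l h"
    using assms by (auto simp: weak_deriv_iff)
  have "AE x in ivl l. g x - h x = 0"
  proof (rule AE_zero_if_test_integrals_zero[OF locally_integrable_diff[OF g h] \<open>0 < l\<close>])
    fix \<phi> assume \<phi>: "test_fun l \<phi>"
    have "(\<integral>x. f x * deriv \<phi> x \<partial>ivl l) = - (\<integral>x. g x * \<phi> x \<partial>ivl l)"
      "(\<integral>x. f x * deriv \<phi> x \<partial>ivl l) = - (\<integral>x. h x * \<phi> x \<partial>ivl l)"
      using assms(1,2) \<phi> unfolding weak_deriv_iff by blast+
    then have "(\<integral>x. g x * \<phi> x \<partial>ivl l) = (\<integral>x. h x * \<phi> x \<partial>ivl l)" by simp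
    then show "(\<integral>x. (g x - h x) * \<phi> x \<partial>ivl l) = 0"
      using integrable_mult_test_fun(1)[OF g \<phi>] integrable_mult_test_fun(1)[OF h \<phi>]
      by (simp add: left_diff_distrib)
  qed
  then show ?thesis by simp
qed

text \<open>The interval has positive length. This turns an almost-everywhere statement that does
  not mention the point into a plain one.\<close>

lemma not_AE_False_ivl: "0 < l \<Longrightarrow> \<not> (AE x in ivl l. False)"
  by (subst AE_ivl[symmetric], subst AE_iff_measurable[of "{0<..<l}"]) auto

text \<open>The primitive starting at the left end of the support vanishes to the left of it; the
  zero mean makes it vanish to the right as well.\<close>

lemma test_fun_antiderivative:
  assumes \<eta>: "test_fun l \<eta>" and zero: "(\<integral>x. \<eta> x \<partial>ivl l) = 0"
  obtains \<phi> where "test_fun l \<phi>" "deriv \<phi> = \<eta>"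
proof -
  obtain a b where ab: "0 < a" "a \<le> b" "b < l" and supp: "\<And>x. x \<notin> {a..b} \<Longrightarrow> \<eta> x = 0"
    and cont: "continuous_on UNIV \<eta>"
    using \<eta> by (auto elim!: test_funE)
  define \<phi> where "\<phi> x = (LBINT y=ereal a..ereal x. \<eta> y)" for x
  have D: "(\<phi> has_real_derivative \<eta> x) (at x)" for x
  proof -
    \<comment> \<open>The fundamental theorem is stated within a closed interval containing the base
      point \<open>a\<close>; the margin 1 puts \<open>x\<close> in its interior.\<close>
    define c d where "c = min x a - 1" and "d = max x a + 1"
    have "((\<lambda>u. LBINT y=ereal a..ereal u. \<eta> y) has_vector_derivative \<eta> x) (at x within {c..d})"
      by (rule interval_integral_FTC2)
        (auto simp: c_def d_def intro: continuous_on_subset[OF cont])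
    moreover have "x \<in> interior {c..d}" by (auto simp: c_def d_def)
    ultimately have "((\<lambda>u. LBINT y=ereal a..ereal u. \<eta> y) has_vector_derivative \<eta> x) (at x)"
      by (simp only: at_within_interior)
    then show ?thesis
      unfolding \<phi>_def[abs_def] has_real_derivative_iff_has_vector_derivative .
  qed
  have "\<phi> x = 0" if "x \<notin> {a..b}" for x
  proof (cases "x < a")
    case True
    then have "\<phi> x = - (LBINT y:{x<..<a}. \<eta> y)"
      unfolding \<phi>_def interval_lebesgue_integral_def by simp
    also have "\<dots> = - (LBINT y:{x<..<a}. 0)"
      by (intro arg_cong[of _ _ uminus] set_lebesgue_integral_cong) (auto intro!: supp)
    finally show ?thesis by (simp add: set_lebesgue_integral_def)
  next
    case False
    then have x: "b < x" "a \<le> x" using that by auto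
    \<comment> \<open>The interval integral runs over the open interval from \<open>a\<close>, so
      the integrands below agree at the point \<open>a\<close> only if \<open>\<eta> a = 0\<close>.
      Continuity from the left gives this.\<close>
    have a0: "\<eta> a = 0"
    proof (rule ccontr)
      assume "\<eta> a \<noteq> 0"
      have "\<forall>\<^sub>F y in at_left a. \<eta> y = 0"
        by (auto simp: eventually_at_filter intro!: always_eventually supp)
      then have "(\<eta> \<longlongrightarrow> 0) (at_left a)" by (rule tendsto_eventually)
      moreover have "(\<eta> \<longlongrightarrow> \<eta> a) (at_left a)"
        using cont by (auto simp: continuous_on_def intro: tendsto_within_subset)
      ultimately show False using \<open>\<eta> a \<noteq> 0\<close> tendsto_unique[of "at_left a"] by auto
    qed
    have "\<phi> x = (LBINT y:{a<..<x}. \<eta> y)"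
      using x unfolding \<phi>_def interval_lebesgue_integral_def by simp
    also have "\<dots> = (LBINT y:{0<..<l}. \<eta> y)"
      unfolding set_lebesgue_integral_def
    proof (rule Bochner_Integration.integral_cong[OF refl])
      fix y
      show "indicator {a<..<x} y *\<^sub>R \<eta> y = indicator {0<..<l} y *\<^sub>R \<eta> y"
        using x ab supp[of y] a0 by (cases "y = a"; cases "y \<in> {a..b}") (auto simp: indicator_def)
    qed
    finally show ?thesis using zero by (simp add: set_integral_ivl)
  qed
  moreover have "\<phi> C1_differentiable_on UNIV"
    by (rule C1_differentiable_on_UNIV_I[OF D cont])
  ultimately have "test_fun l \<phi>" using ab unfolding test_fun_def by blast
  moreover have "deriv \<phi> = \<eta>" using D by (auto intro!: ext DERIV_imp_deriv)
  ultimately show ?thesis by (rule that)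
qed

text \<open>Subtracting from a test function the right multiple of a fixed \<open>\<psi>0\<close>
  with nonzero integral leaves mean zero, hence the derivative of a test function. Thus
  \<open>g\<close> pairs with every test function as the constant \<open>c\<close> does.\<close>

lemma du_Bois_Reymond:
  assumes g: "locally_integrable l g" and l: "0 < l"
    and zero: "\<And>\<phi>. test_fun l \<phi> \<Longrightarrow> (\<integral>x. g x * deriv \<phi> x \<partial>ivl l) = 0"
  obtains c where "AE x in ivl l. g x = c"
proof -
  \<comment> \<open>If all test functions had integral 0, the fundamental lemma would make the
    constant 1 vanish almost everywhere.\<close>
  obtain \<psi>0 where \<psi>0: "test_fun l \<psi>0" and m: "(\<integral>x. \<psi>0 x \<partial>ivl l) \<noteq> 0"
    using AE_zero_if_test_integrals_zero[OF locally_integrable_const[of l 1] l] not_AE_False_ivl[OF l]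
    by fastforce
  define m where "m = (\<integral>x. \<psi>0 x \<partial>ivl l)"
  define c where "c = (\<integral>x. g x * \<psi>0 x \<partial>ivl l) / m"
  have "AE x in ivl l. g x - c = 0"
  proof (rule AE_zero_if_test_integrals_zero[OF locally_integrable_diff[OF g locally_integrable_const] l])
    fix \<psi> assume \<psi>: "test_fun l \<psi>"
    define k where "k = (\<integral>x. \<psi> x \<partial>ivl l) / m"
    let ?\<eta> = "\<lambda>x. \<psi> x - k * \<psi>0 x"
    note int1 = integrable_mult_test_fun(1)[OF locally_integrable_const[of l 1] \<psi>, simplified]
      integrable_mult_test_fun(1)[OF locally_integrable_const[of l 1] \<psi>0, simplified]
    note intg = integrable_mult_test_fun(1)[OF g \<psi>] integrable_mult_test_fun(1)[OF g \<psi>0]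
    have "(\<integral>x. ?\<eta> x \<partial>ivl l) = 0"
      using int1 m by (simp add: k_def m_def)
    then obtain \<phi> where \<phi>: "test_fun l \<phi>" "deriv \<phi> = ?\<eta>"
      using test_fun_antiderivative[OF test_fun_diff_cmult[OF \<psi> \<psi>0, of k]] by metis
    have "0 = (\<integral>x. g x * \<psi> x - k * (g x * \<psi>0 x) \<partial>ivl l)"
      using zero[OF \<phi>(1)] \<phi>(2) by (simp add: algebra_simps)
    also have "\<dots> = (\<integral>x. g x * \<psi> x \<partial>ivl l) - k * (\<integral>x. g x * \<psi>0 x \<partial>ivl l)"
      using intg by simp
    finally have "(\<integral>x. g x * \<psi> x \<partial>ivl l) = c * (\<integral>x. \<psi> x \<partial>ivl l)"
      by (simp add: k_def c_def)
    then show "(\<integral>x. (g x - c) * \<psi> x \<partial>ivl l) = 0"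
      using intg int1 by (simp add: left_diff_distrib)
  qed
  then show ?thesis by (intro that[of c]) simp
qed

section \<open>Primitives of weak derivatives by Fubini\<close>

lemma borel_measurable_id_ivl [measurable]: "(\<lambda>x. x) \<in> borel_measurable (ivl l)"
  by (rule borel_measurable_ivl) simp

lemma pair_sigma_finite_ivl: "pair_sigma_finite (ivl l) (ivl l)"
  by (intro pair_sigma_finite.intro finite_measure.axioms finite_measure_ivl)

text \<open>As a function of \<open>x\<close>, the factor \<open>indicator {..s} x\<close> produces
  the integral from 0 to \<open>s\<close>; as a function of \<open>s\<close>, it produces the tail
  from \<open>x\<close> to \<open>l\<close>. Fubini applied to this kernel takes the place of
  integration by parts.\<close>

lemma integrable_triangle_kernel:
  fixes v :: "real \<Rightarrow> real"
  assumes v: "integrable (ivl l) v"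
  shows "integrable (ivl l \<Otimes>\<^sub>M ivl l) (\<lambda>(s, x). indicator {..s} x * v x)"
proof -
  interpret pair_sigma_finite "ivl l" "ivl l" by (rule pair_sigma_finite_ivl)
  interpret finite_measure "ivl l" by (rule finite_measure_ivl)
  have [measurable]: "v \<in> borel_measurable (ivl l)" using v by simp
  have "integrable (ivl l \<Otimes>\<^sub>M ivl l) (\<lambda>(s, x). v x)"
    by (rule Fubini_integrable) (use v in \<open>auto\<close>)
  then show ?thesis
    by (rule Bochner_Integration.integrable_bound) (auto simp: indicator_def split_beta')
qed

text \<open>By Fubini the primitive \<open>V\<close> of \<open>v\<close> has weak derivative
  \<open>v\<close>. Hence \<open>F - V\<close> annihilates all derivatives of test functions and is
  constant.\<close>

lemma weak_deriv_primitive: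
  assumes F: "weak_deriv l F v" and v: "integrable (ivl l) v" and l: "0 < l"
  obtains c where "AE s in ivl l. F s = c + (\<integral>x. indicator {..s} x * v x \<partial>ivl l)"
proof -
  interpret pair_sigma_finite "ivl l" "ivl l" by (rule pair_sigma_finite_ivl)
  have vm[measurable]: "v \<in> borel_measurable (ivl l)" using v by simp
  define V where "V s = (\<integral>x. indicator {..s} x * v x \<partial>ivl l)" for s
  note K = integrable_triangle_kernel[OF v]
  have V: "integrable (ivl l) V"
    using integrable_fst'[OF K] by (simp add: V_def[abs_def])
  note lF = F[unfolded weak_deriv_iff, THEN conjunct1]
  note lV = integrable_imp_locally_integrable[OF V]
  obtain c where "AE s in ivl l. F s - V s = c"
  proof (rule du_Bois_Reymond[OF locally_integrable_diff[OF lF lV] l])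
    fix \<phi> assume \<phi>: "test_fun l \<phi>"
    obtain a b where ab: "0 < a" "a \<le> b" "b < l" and supp: "\<And>x. x \<notin> {a..b} \<Longrightarrow> \<phi> x = 0"
      "\<And>x. x \<notin> {a..b} \<Longrightarrow> deriv \<phi> x = 0" and D: "\<And>x. (\<phi> has_real_derivative deriv \<phi> x) (at x)"
      and cont: "continuous_on UNIV \<phi>" "continuous_on UNIV (deriv \<phi>)"
      using test_funE[OF \<phi>] by metis
    have dm[measurable]: "deriv \<phi> \<in> borel_measurable (ivl l)"
      using cont(2) by (intro borel_measurable_ivl borel_measurable_continuous_onI)
    have "bounded (deriv \<phi> ` {a..b})"
      using cont(2) by (intro compact_imp_bounded compact_continuous_image) (auto intro: continuous_on_subset)
    then obtain B where B: "\<forall>x\<in>{a..b}. \<bar>deriv \<phi> x\<bar> \<le> B"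
      by (auto simp: bounded_iff)
    \<comment> \<open>Off the support the derivative is 0, so the bound holds everywhere;
      \<open>\<bar>B\<bar>\<close> avoids a discussion of the sign of \<open>B\<close>.\<close>
    then have B': "\<bar>deriv \<phi> x\<bar> \<le> \<bar>B\<bar>" for x
      using supp(2)[of x] by (cases "x \<in> {a..b}") force+
    have KB: "integrable (ivl l \<Otimes>\<^sub>M ivl l) (\<lambda>(s, x). indicator {..s} x * v x * deriv \<phi> s)"
    proof (rule Bochner_Integration.integrable_bound)
      show "integrable (ivl l \<Otimes>\<^sub>M ivl l) (\<lambda>z. \<bar>B\<bar> * (case z of (s, x) \<Rightarrow> indicator {..s} x * v x))"
        using K by simp
      show "AE z in ivl l \<Otimes>\<^sub>M ivl l. norm (case z of (s, x) \<Rightarrow> indicator {..s} x * v x * deriv \<phi> s)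
          \<le> norm (\<bar>B\<bar> * (case z of (s, x) \<Rightarrow> indicator {..s} x * v x))"
        using B' by (intro AE_I2)
          (auto simp: abs_mult split_beta' indicator_def mult.commute[of "\<bar>B\<bar>"] intro!: mult_left_mono)
    qed (simp add: split_beta' indicator_def)
    \<comment> \<open>This is the fundamental theorem on [x, l] with \<open>\<phi> l = 0\<close>.
      Adding the endpoint \<open>l\<close> to the domain is harmless because
      \<open>deriv \<phi> l = 0\<close>.\<close>
    have tail: "(\<integral>s. indicator {..s} x * deriv \<phi> s \<partial>ivl l) = - \<phi> x" if x: "x \<in> {0<..<l}" for x
    proof -
      have "(\<integral>s. indicator {..s} x * deriv \<phi> s \<partial>ivl l)
          = (\<integral>s. indicator {0<..<l} s *\<^sub>R (indicator {..s} x * deriv \<phi> s) \<partial>lborel)"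
        by (simp add: integral_restrict_space)
      also have "\<dots> = (\<integral>s. deriv \<phi> s * indicator {x..l} s \<partial>lborel)"
        using x supp(2)[of l] ab
        by (intro Bochner_Integration.integral_cong) (auto simp: indicator_def)
      also have "\<dots> = \<phi> l - \<phi> x"
        using x D cont(2) by (intro integral_FTC_Icc_real) (auto simp: continuous_on_eq_continuous_at)
      finally show ?thesis using supp(1)[of l] ab by simp
    qed
    have "(\<integral>s. V s * deriv \<phi> s \<partial>ivl l)
        = (\<integral>s. (\<integral>x. indicator {..s} x * v x * deriv \<phi> s \<partial>ivl l) \<partial>ivl l)"
      by (simp add: V_def)
    also have "\<dots> = (\<integral>x. (\<integral>s. indicator {..s} x * v x * deriv \<phi> s \<partial>ivl l) \<partial>ivl l)"
      using Fubini_integral[OF KB] by simp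
    also have "\<dots> = (\<integral>x. v x * (\<integral>s. indicator {..s} x * deriv \<phi> s \<partial>ivl l) \<partial>ivl l)"
      by (subst integral_mult_right_zero[symmetric]) (simp add: ac_simps)
    also have "\<dots> = (\<integral>x. - (v x * \<phi> x) \<partial>ivl l)"
      by (rule Bochner_Integration.integral_cong) (simp_all add: tail space_restrict_space)
    also have "\<dots> = (\<integral>x. F x * deriv \<phi> x \<partial>ivl l)"
      using F \<phi> by (simp add: weak_deriv_iff)
    finally show "(\<integral>x. (F x - V x) * deriv \<phi> x \<partial>ivl l) = 0"
      using integrable_mult_test_fun(2)[OF lF \<phi>] integrable_mult_test_fun(2)[OF lV \<phi>]
      by (simp add: left_diff_distrib)
  qed
  then have "AE s in ivl l. F s = c + V s" by eventually_elim auto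
  then show ?thesis by (rule that[unfolded V_def[symmetric]])
qed

section \<open>The weighted energy space\<close>

lemma integrable_powr_ivl:
  assumes "-1 < \<beta>" "0 < l"
  shows "integrable (ivl l) (\<lambda>x. x powr \<beta>)"
proof -
  have "(\<lambda>x. x powr \<beta>) absolutely_integrable_on {0..l}"
    using assms by (intro nonnegative_absolutely_integrable_1 integrable_on_powr_from_0) auto
  then have "(\<lambda>x. x powr \<beta>) absolutely_integrable_on {0<..<l}"
    by (rule set_integrable_subset) auto
  then have "set_integrable lborel {0<..<l} (\<lambda>x. x powr \<beta>)"
    unfolding set_integrable_def by (subst (asm) integrable_completion) auto
  then show ?thesis by (simp only: set_integrable_ivl)
qed

lemma not_integrable_inverse_ivl:
  assumes "0 < l"
  shows "\<not> integrable (ivl l) (\<lambda>x. 1 / x)"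
proof
  assume "integrable (ivl l) (\<lambda>x. 1 / x)"
  then have i: "integrable lborel (\<lambda>x. indicator {0<..<l} x * (1 / x))"
    by (simp add: integrable_restrict_space)
  define I where "I = (\<integral>x. indicator {0<..<l} x * (1 / x) \<partial>lborel)"
  have I0: "I \<ge> 0" unfolding I_def by (rule integral_nonneg_AE) (auto simp: indicator_def)
  define m where "m = l / 2"
  \<comment> \<open>Chosen so that 1/x has integral \<open>I + 1\<close> over [e, m], more than the
    supposed total \<open>I\<close>.\<close>
  define e where "e = m * exp (- (I + 1))"
  have m: "0 < m" "m < l" using assms by (auto simp: m_def)
  have "exp (- (I + 1)) \<le> 1" using I0 by simp
  then have e: "0 < e" "e \<le> m" using m by (auto simp: e_def mult_le_cancel_left1)
  have FTC: "has_bochner_integral lborel (\<lambda>x. 1 / x * indicator {e..m} x) (ln m - ln e)"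
    using e m by (intro has_bochner_integral_FTC_Icc_real) (auto intro!: derivative_eq_intros continuous_intros)
  have "ln m - ln e = I + 1"
    using m by (simp add: e_def ln_mult)
  moreover have "ln m - ln e \<le> I"
    unfolding I_def using FTC i e m
    by (subst has_bochner_integral_integral_eq[OF FTC, symmetric], intro integral_mono)
       (auto simp: has_bochner_integral_iff indicator_def)
  ultimately show False by simp
qed

text \<open>The common source of contradiction for finite energies: both later uses bound
  \<open>x powr \<alpha> * (u' x)\<^sup>2\<close> from below by a multiple of 1/x near 0.\<close>

lemma integrable_not_ge_inverse:
  assumes f: "integrable (ivl l) f" and "0 < k" "0 < d" "d \<le> l"
    and ge: "AE x in ivl l. x < d \<longrightarrow> k / x \<le> f x"
  shows False
proof -
  have "set_integrable lborel {0<..<d} f"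
    by (rule set_integrable_subset[OF f[unfolded set_integrable_ivl[symmetric]]])
      (use \<open>d \<le> l\<close> in auto)
  then have fd: "integrable (ivl d) f" by (simp only: set_integrable_ivl)
  have "AE x in ivl d. k / x \<le> f x"
    unfolding AE_ivl[symmetric] using ge[unfolded AE_ivl[symmetric]]
    by eventually_elim (use \<open>d \<le> l\<close> in auto)
  then have "AE x in ivl d. norm (1 / x) \<le> norm (1 / k * f x)"
    unfolding AE_ivl[symmetric]
  proof eventually_elim
    case (elim x)
    show ?case
    proof
      assume x: "x \<in> {0<..<d}"
      then have "0 < k / x" using \<open>0 < k\<close> by simp
      then have "k / x \<le> \<bar>f x\<bar>" using elim x by linarith
      then show "norm (1 / x) \<le> norm (1 / k * f x)"
        using x \<open>0 < k\<close> by (simp add: abs_mult field_simps)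
    qed
  qed
  then have "integrable (ivl d) (\<lambda>x. 1 / x)"
    by (intro Bochner_Integration.integrable_bound[OF integrable_mult_right[OF fd, of "1/k"]])
      measurable
  then show False using not_integrable_inverse_ivl[OF \<open>0 < d\<close>] by simp
qed

lemma set_integral_tail_ivl:
  fixes f :: "real \<Rightarrow> real"
  assumes "x \<in> {0<..<l}"
  shows "(LBINT s:{x..<l}. f s) = (\<integral>s. indicator {..s} x * f s \<partial>ivl l)"
    and "(LBINT s:{0<..x}. f s) = (\<integral>s. indicator {..x} s * f s \<partial>ivl l)"
  using assms unfolding set_lebesgue_integral_def
  by (auto simp: integral_restrict_space indicator_def intro!: Bochner_Integration.integral_cong)

section \<open>Consequences of finite energy and the boundary conditions\<close>

lemma powr_half_mult_self: "0 < x \<Longrightarrow> x powr (a / 2) * x powr (a / 2) = x powr a" for x a :: real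
  by (simp add: powr_add[symmetric])

text \<open>Fixes one representative \<open>u'\<close> of the space derivative together with its
  flux, so that energy, traces and flux all refer to the same function.\<close>

locale weighted_H1 =
  fixes \<alpha> l :: real and u u' :: "real \<Rightarrow> real"
  assumes l: "0 < l" and \<alpha>: "0 \<le> \<alpha>" "\<alpha> < 2"
    and H1: "H1_alpha \<alpha> l u u'"
    and flux: "L2_on l (\<lambda>x. x powr \<alpha> * u' x)"
begin

text \<open>On (0, l) the weight is nonzero, so measurability passes from the flux to
  \<open>u'\<close> on division by the weight.\<close>

lemma u'_measurable [measurable]: "u' \<in> borel_measurable (ivl l)"
proof -
  have [measurable]: "(\<lambda>x. x powr \<alpha> * u' x) \<in> borel_measurable (ivl l)"
    using flux by (simp add: L2_on_iff sq_integrable_def)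
  have [measurable]: "(\<lambda>x::real. x powr (- \<alpha>)) \<in> borel_measurable (ivl l)"
    by (rule borel_measurable_ivl) simp
  have "(\<lambda>x. x powr (- \<alpha>) * (x powr \<alpha> * u' x)) \<in> borel_measurable (ivl l)"
    by measurable
  also have "?this \<longleftrightarrow> u' \<in> borel_measurable (ivl l)"
    by (rule measurable_cong) (auto simp: space_restrict_space powr_minus)
  finally show ?thesis .
qed

lemma powr_measurable [measurable]: "(\<lambda>x::real. x powr \<beta>) \<in> borel_measurable (ivl l)"
  by (rule borel_measurable_ivl) simp

lemma energy_integrable: "integrable (ivl l) (\<lambda>x. x powr \<alpha> * (u' x)\<^sup>2)"
  using H1 by (simp add: H1_alpha_def set_integrable_ivl)

lemma sq_integrable_energy: "sq_integrable (ivl l) (\<lambda>x. x powr (\<alpha> / 2) * u' x)"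
proof -
  have "integrable (ivl l) (\<lambda>x. (x powr (\<alpha> / 2) * u' x)\<^sup>2) \<longleftrightarrow> integrable (ivl l) (\<lambda>x. x powr \<alpha> * (u' x)\<^sup>2)"
    by (rule Bochner_Integration.integrable_cong)
      (auto simp: space_restrict_space power_mult_distrib power2_eq_square powr_half_mult_self)
  then show ?thesis using energy_integrable by (simp add: sq_integrable_def)
qed

text \<open>Cauchy-Schwarz for the factors \<open>x powr (\<beta> - \<alpha> / 2)\<close> and
  \<open>x powr (\<alpha> / 2) * u' x\<close>; the hypothesis makes the first one square integrable.
  It is used with \<open>\<beta> = 0\<close> for \<open>\<alpha> < 1\<close>, and with
  \<open>\<beta> = 1/2\<close> for every \<open>\<alpha> < 2\<close>.\<close>

lemma integrable_powr_mult_u':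
  assumes "2 * \<beta> - \<alpha> > -1"
  shows "integrable (ivl l) (\<lambda>x. x powr \<beta> * u' x)"
proof -
  have "sq_integrable (ivl l) (\<lambda>x. x powr (\<beta> - \<alpha> / 2))"
  proof -
    have "integrable (ivl l) (\<lambda>x. (x powr (\<beta> - \<alpha> / 2))\<^sup>2) \<longleftrightarrow> integrable (ivl l) (\<lambda>x. x powr (2 * \<beta> - \<alpha>))"
      by (rule Bochner_Integration.integrable_cong)
        (auto simp: space_restrict_space power2_eq_square powr_add[symmetric])
    then show ?thesis using integrable_powr_ivl[OF assms l] by (simp add: sq_integrable_def)
  qed
  from integrable_mult_sq_integrable[OF this sq_integrable_energy]
  have "integrable (ivl l) (\<lambda>x. x powr (\<beta> - \<alpha> / 2) * (x powr (\<alpha> / 2) * u' x))" .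
  also have "?this \<longleftrightarrow> ?thesis"
    by (rule Bochner_Integration.integrable_cong)
      (auto simp: space_restrict_space mult.assoc[symmetric] powr_add[symmetric])
  finally show ?thesis .
qed

lemma u_sq_integrable: "sq_integrable (ivl l) u"
  using H1 by (simp add: H1_alpha_def L2_on_iff)

lemma u_eq: "AE x in ivl l. u x = - (\<integral>s. indicator {..s} x * u' s \<partial>ivl l)"
  unfolding AE_ivl[symmetric] using H1[unfolded H1_alpha_def, THEN conjunct2, THEN conjunct2, THEN conjunct2, THEN conjunct1]
  by eventually_elim (simp add: set_integral_tail_ivl)

lemma integrable_u':
  assumes "\<alpha> < 1"
  shows "integrable (ivl l) u'"
proof -
  have "integrable (ivl l) (\<lambda>x. x powr 0 * u' x)"
    by (rule integrable_powr_mult_u') (use assms in auto)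
  also have "?this \<longleftrightarrow> ?thesis"
    by (rule Bochner_Integration.integrable_cong) (auto simp: space_restrict_space)
  finally show ?thesis .
qed

text \<open>For \<open>\<alpha> < 1\<close> the two zero traces represent \<open>u x\<close> both as
  the integral of \<open>u'\<close> from 0 to \<open>x\<close> and as minus its integral from
  \<open>x\<close> to \<open>l\<close>. Comparing them shows that the whole integral
  vanishes.\<close>

lemma integral_u'_eq_0:
  assumes "\<alpha> < 1"
  shows "(\<integral>s. u' s \<partial>ivl l) = 0"
proof -
  have "AE x in lborel. x \<in> {0<..<l} \<longrightarrow> u x = (LBINT s:{0<..x}. u' s)"
    using H1 assms by (simp add: H1_alpha_def)
  moreover have "AE x in lborel. x \<in> {0<..<l} \<longrightarrow> u x = - (LBINT s:{x..<l}. u' s)"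
    using H1 by (simp add: H1_alpha_def)
  moreover have "AE x in lborel. x \<in> {0<..<l} \<longrightarrow>
      (LBINT s:{0<..x}. u' s) + (LBINT s:{x..<l}. u' s) = (\<integral>s. u' s \<partial>ivl l)"
  proof (intro AE_I2 impI)
    fix x assume x: "x \<in> {0<..<l}"
    have i: "integrable (ivl l) (\<lambda>s. indicator {..x} s * u' s)"
      "integrable (ivl l) (\<lambda>s. indicator {..s} x * u' s)"
      by (rule Bochner_Integration.integrable_bound[OF integrable_u'[OF assms]];
          simp add: indicator_def)+
    \<comment> \<open>Both kernels contain the point \<open>s = x\<close>, which is counted twice
      but is a null set.\<close>
    have "AE s in lborel. s \<noteq> x" by (rule AE_lborel_singleton)
    then have "AE s in ivl l. s \<noteq> x"
      unfolding AE_ivl[symmetric] by eventually_elim simp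
    then have "AE s in ivl l. indicator {..x} s * u' s + indicator {..s} x * u' s = u' s"
      by eventually_elim (auto simp: indicator_def)
    then have "(\<integral>s. indicator {..x} s * u' s + indicator {..s} x * u' s \<partial>ivl l) = (\<integral>s. u' s \<partial>ivl l)"
      by (rule integral_cong_AE[rotated 2]) (simp_all add: indicator_def)
    then show "(LBINT s:{0<..x}. u' s) + (LBINT s:{x..<l}. u' s) = (\<integral>s. u' s \<partial>ivl l)"
      using i by (simp add: set_integral_tail_ivl[OF x])
  qed
  ultimately have "AE x in lborel. x \<in> {0<..<l} \<longrightarrow> (\<integral>s. u' s \<partial>ivl l) = 0"
    by eventually_elim auto
  then have "AE x in ivl l. (\<integral>s. u' s \<partial>ivl l) = 0" by (simp only: AE_ivl)
  then show ?thesis using not_AE_False_ivl[OF l] by (cases "(\<integral>s. u' s \<partial>ivl l) = 0") auto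
qed

end

section \<open>Symmetry of the generator\<close>

text \<open>Cauchy-Schwarz against the indicator of (0, s]. The factor \<open>sqrt s\<close> is the
  decay at 0 that compensates for the degenerate weight.\<close>

lemma integral_initial_segment_le:
  assumes v: "sq_integrable (ivl l) v" and s: "s \<in> {0<..<l}"
  shows "(\<integral>x. indicator {..s} x * \<bar>v x\<bar> \<partial>ivl l) \<le> sqrt s * l2_norm (ivl l) v"
proof -
  interpret finite_measure "ivl l" by (rule finite_measure_ivl)
  have abs: "sq_integrable (ivl l) (\<lambda>x. \<bar>v x\<bar>)"
    using v by (auto simp: sq_integrable_def)
  have "(\<integral>x. (indicator {..s} x :: real)\<^sup>2 \<partial>ivl l) = (\<integral>x. indicator {0<..s} x \<partial>lborel)"
    unfolding integral_restrict_space[of "{0<..<l}" lborel, simplified]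
    using s by (intro Bochner_Integration.integral_cong) (auto simp: indicator_def)
  also have "\<dots> = s" using s by simp
  finally have norm: "l2_norm (ivl l) (indicator {..s}) = sqrt s"
    by (simp add: l2_norm_def)
  have "sq_integrable (ivl l) (indicator {..s})"
    unfolding sq_integrable_def
  proof
    show m: "(indicator {..s} :: real \<Rightarrow> real) \<in> borel_measurable (ivl l)"
      by (rule borel_measurable_ivl) simp
    show "integrable (ivl l) (\<lambda>x. (indicator {..s} x :: real)\<^sup>2)"
      by (rule integrable_const_bound[of _ 1]) (use m in \<open>auto simp: indicator_def\<close>)
  qed
  from l2_norm_Cauchy_Schwarz[OF this abs]
  have "\<bar>\<integral>x. indicator {..s} x * \<bar>v x\<bar> \<partial>ivl l\<bar> \<le> sqrt s * l2_norm (ivl l) (\<lambda>x. \<bar>v x\<bar>)"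
    by (simp add: norm)
  then show ?thesis by (simp add: l2_norm_def)
qed

context weighted_H1
begin

text \<open>The constant \<open>c\<close> is the boundary value of the flux at 0, so this is the
  zero-flux condition of the strongly degenerate case, obtained from finite energy. If
  \<open>c\<close> were nonzero, the flux would exceed \<open>\<bar>c\<bar> / 2\<close> in size near
  0, and the energy density, which is the squared flux over \<open>x powr \<alpha>\<close>, would be
  at least \<open>c\<^sup>2 / 4 / x\<close>.\<close>

lemma flux_const_eq_0:
  assumes v: "sq_integrable (ivl l) v" and "1 \<le> \<alpha>"
    and F: "AE s in ivl l. s powr \<alpha> * u' s = c + (\<integral>x. indicator {..s} x * v x \<partial>ivl l)"
  shows "c = 0"
proof (rule ccontr)
  assume c: "c \<noteq> 0"
  define N where "N = l2_norm (ivl l) v"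
  \<comment> \<open>With \<open>sqrt x \<le> r\<close> the integral part of the flux is at most
    \<open>r * N \<le> \<bar>c\<bar> / 2\<close>. The summand 1 keeps the denominator positive, and
    \<open>d \<le> 1\<close> below is for comparing \<open>x powr \<alpha>\<close> with
    \<open>x\<close>.\<close>
  define r where "r = \<bar>c\<bar> / (2 * (N + 1))"
  define d where "d = min (min l 1) (r\<^sup>2)"
  have N: "0 \<le> N" by (simp add: N_def)
  then have r: "0 < r" using c by (simp add: r_def)
  have d: "0 < d" "d \<le> l" "d \<le> 1" "d \<le> r\<^sup>2" using l r by (auto simp: d_def)
  show False
  proof (rule integrable_not_ge_inverse[OF energy_integrable _ d(1,2)])
    show "0 < c\<^sup>2 / 4" using c by simp
    show "AE x in ivl l. x < d \<longrightarrow> c\<^sup>2 / 4 / x \<le> x powr \<alpha> * (u' x)\<^sup>2"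
      unfolding AE_ivl[symmetric] using F[unfolded AE_ivl[symmetric]]
    proof eventually_elim
      case (elim x)
      show ?case
      proof (intro impI)
        assume x: "x \<in> {0<..<l}" "x < d"
        then have x0: "0 < x" "x < 1" using d by auto
        have "\<bar>\<integral>y. indicator {..x} y * v y \<partial>ivl l\<bar> \<le> (\<integral>y. \<bar>indicator {..x} y * v y\<bar> \<partial>ivl l)"
          by (rule integral_abs_bound)
        also have "\<dots> = (\<integral>y. indicator {..x} y * \<bar>v y\<bar> \<partial>ivl l)" by (simp add: abs_mult)
        also have "\<dots> \<le> sqrt x * N" unfolding N_def by (rule integral_initial_segment_le[OF v x(1)])
        also have "\<dots> \<le> r * N"
          using x d r N by (intro mult_right_mono real_le_lsqrt) auto
        also have "\<dots> \<le> \<bar>c\<bar> / 2" using N by (simp add: r_def field_simps)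
        finally have "\<bar>c\<bar> / 2 \<le> \<bar>c + (\<integral>y. indicator {..x} y * v y \<partial>ivl l)\<bar>" by linarith
        then have "\<bar>c\<bar> / 2 \<le> \<bar>x powr \<alpha> * u' x\<bar>" using elim x(1) by (simp only:)
        then have "(\<bar>c\<bar> / 2)\<^sup>2 \<le> \<bar>x powr \<alpha> * u' x\<bar>\<^sup>2" by (rule power_mono) simp
        then have "c\<^sup>2 / 4 \<le> x powr \<alpha> * (x powr \<alpha> * (u' x)\<^sup>2)"
          by (simp add: power_divide power_mult_distrib) (simp add: power2_eq_square ac_simps)
        also have "\<dots> \<le> x powr 1 * (x powr \<alpha> * (u' x)\<^sup>2)"
          using x0 \<open>1 \<le> \<alpha>\<close> by (intro mult_right_mono powr_mono') auto
        finally show "c\<^sup>2 / 4 / x \<le> x powr \<alpha> * (u' x)\<^sup>2"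
          using x0 by (simp add: pos_divide_le_eq mult.commute)
      qed
    qed
  qed
qed

end

text \<open>The flux is \<open>c\<close> plus the primitive of \<open>v\<close>, so the exchange of
  integrals leaves the extra term \<open>c\<close> times the integral of \<open>p'\<close>. It
  vanishes in both regimes: \<open>c = 0\<close> for \<open>1 \<le> \<alpha>\<close>, and
  \<open>p'\<close> has integral 0 for \<open>\<alpha> < 1\<close>.\<close>

lemma green_identity:
  assumes u: "weighted_H1 \<alpha> l u u'" and p: "weighted_H1 \<alpha> l p p'"
    and v: "L2_on l v" and wd: "weak_deriv l (\<lambda>x. x powr \<alpha> * u' x) v"
  shows "(\<integral>x. v x * p x \<partial>ivl l) = - (\<integral>s. s powr \<alpha> * u' s * p' s \<partial>ivl l)"
proof -
  interpret u: weighted_H1 \<alpha> l u u' by (rule u)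
  interpret p: weighted_H1 \<alpha> l p p' by (rule p)
  interpret pair_sigma_finite "ivl l" "ivl l" by (rule pair_sigma_finite_ivl)
  have v2: "sq_integrable (ivl l) v" using v by (simp add: L2_on_iff)
  then have v1: "integrable (ivl l) v" by (rule sq_integrable_ivl_integrable)
  have [measurable]: "v \<in> borel_measurable (ivl l)" using v2 by (rule sq_integrable_measurable)
  define V where "V s = (\<integral>x. indicator {..s} x * v x \<partial>ivl l)" for s
  obtain c where F: "AE s in ivl l. s powr \<alpha> * u' s = c + V s"
    using weak_deriv_primitive[OF wd v1 u.l] unfolding V_def .
  have c0: "c = 0" if "1 \<le> \<alpha>"
    using u.flux_const_eq_0[OF v2 that] F unfolding V_def .
  let ?K = "\<lambda>s x. indicator {..s} x * v x * p' s"
  \<comment> \<open>The inner integral of \<open>\<bar>v\<bar>\<close> is at most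
    \<open>sqrt s\<close> times the norm of \<open>v\<close>, so absolute integrability reduces to
    that of \<open>s powr (1/2) * p' s\<close>, which holds since
    \<open>\<alpha> < 2\<close>.\<close>
  have K: "integrable (ivl l \<Otimes>\<^sub>M ivl l) (case_prod ?K)"
  proof (rule Fubini_integrable)
    show [measurable]: "case_prod ?K \<in> borel_measurable (ivl l \<Otimes>\<^sub>M ivl l)"
      by (simp add: split_beta' indicator_def)
    have eq: "(\<integral>x. norm (?K s x) \<partial>ivl l) = \<bar>p' s\<bar> * (\<integral>x. indicator {..s} x * \<bar>v x\<bar> \<partial>ivl l)" for s
      by (subst integral_mult_right_zero[symmetric]) (simp add: abs_mult ac_simps)
    show "integrable (ivl l) (\<lambda>s. \<integral>x. norm (case (s, x) of (s, x) \<Rightarrow> ?K s x) \<partial>ivl l)"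
    proof (rule Bochner_Integration.integrable_bound)
      show "integrable (ivl l) (\<lambda>s. l2_norm (ivl l) v * (s powr (1/2) * p' s))"
        using p.integrable_powr_mult_u'[of "1/2"] p.\<alpha> by simp
      show "(\<lambda>s. \<integral>x. norm (case (s, x) of (s, x) \<Rightarrow> ?K s x) \<partial>ivl l) \<in> borel_measurable (ivl l)"
        by measurable
      show "AE s in ivl l. norm (\<integral>x. norm (case (s, x) of (s, x) \<Rightarrow> ?K s x) \<partial>ivl l)
          \<le> norm (l2_norm (ivl l) v * (s powr (1/2) * p' s))"
      proof (rule AE_I2)
        fix s assume "s \<in> space (ivl l)"
        then have s: "s \<in> {0<..<l}" by (simp add: space_restrict_space)
        have "0 \<le> (\<integral>x. indicator {..s} x * \<bar>v x\<bar> \<partial>ivl l)" by simp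
        then show "norm (\<integral>x. norm (case (s, x) of (s, x) \<Rightarrow> ?K s x) \<partial>ivl l)
          \<le> norm (l2_norm (ivl l) v * (s powr (1/2) * p' s))"
          using mult_left_mono[OF integral_initial_segment_le[OF v2 s], of "\<bar>p' s\<bar>"] s
          unfolding prod.case eq by (simp add: abs_mult powr_half_sqrt ac_simps)
      qed
    qed
    show "AE s in ivl l. integrable (ivl l) (\<lambda>x. case (s, x) of (s, x) \<Rightarrow> ?K s x)"
    proof (rule AE_I2)
      fix s
      have "integrable (ivl l) (\<lambda>x. indicator {..s} x * v x)"
        by (rule Bochner_Integration.integrable_bound[OF v1]) (auto simp: indicator_def)
      then show "integrable (ivl l) (\<lambda>x. case (s, x) of (s, x) \<Rightarrow> ?K s x)" by simp
    qed
  qed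
  have "(\<integral>x. v x * p x \<partial>ivl l) = (\<integral>x. - (\<integral>s. ?K s x \<partial>ivl l) \<partial>ivl l)"
  proof (rule integral_cong_AE)
    show "AE x in ivl l. v x * p x = - (\<integral>s. ?K s x \<partial>ivl l)"
      using p.u_eq
    proof eventually_elim
      case (elim x)
      have "(\<integral>s. ?K s x \<partial>ivl l) = v x * (\<integral>s. indicator {..s} x * p' s \<partial>ivl l)"
        by (subst integral_mult_right_zero[symmetric]) (simp add: ac_simps)
      then show ?case using elim by simp
    qed
    show "(\<lambda>x. v x * p x) \<in> borel_measurable (ivl l)"
      using p.u_sq_integrable by (auto simp: sq_integrable_def)
    show "(\<lambda>x. - (\<integral>s. ?K s x \<partial>ivl l)) \<in> borel_measurable (ivl l)"
      using integrable_snd[OF K] by simp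
  qed
  also have "\<dots> = - (\<integral>s. (\<integral>x. ?K s x \<partial>ivl l) \<partial>ivl l)"
    using Fubini_integral[OF K] by simp
  also have "(\<integral>s. (\<integral>x. ?K s x \<partial>ivl l) \<partial>ivl l) = (\<integral>s. V s * p' s \<partial>ivl l)"
    by (simp add: V_def)
  also have "\<dots> = (\<integral>s. s powr \<alpha> * u' s * p' s - c * p' s \<partial>ivl l)"
  proof (rule integral_cong_AE)
    show "AE s in ivl l. V s * p' s = s powr \<alpha> * u' s * p' s - c * p' s"
      using F by eventually_elim (simp add: left_diff_distrib[symmetric])
    have "integrable (ivl l) V"
      using integrable_fst'[OF integrable_triangle_kernel[OF v1]] by (simp add: V_def[abs_def])
    then have [measurable]: "V \<in> borel_measurable (ivl l)" by simp
    show "(\<lambda>s. V s * p' s) \<in> borel_measurable (ivl l)" by simp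
    show "(\<lambda>s. s powr \<alpha> * u' s * p' s - c * p' s) \<in> borel_measurable (ivl l)" by simp
  qed
  \<comment> \<open>Removal of the term with \<open>c\<close>. For \<open>\<alpha> < 1\<close> the
    integral is split, which requires integrability of both summands.\<close>
  also have "\<dots> = (\<integral>s. s powr \<alpha> * u' s * p' s \<partial>ivl l)"
  proof (cases "1 \<le> \<alpha>")
    case True
    then show ?thesis using c0 by simp
  next
    case False
    have "integrable (ivl l) (\<lambda>s. (s powr (\<alpha> / 2) * u' s) * (s powr (\<alpha> / 2) * p' s))"
      by (intro integrable_mult_sq_integrable u.sq_integrable_energy p.sq_integrable_energy)
    also have "?this \<longleftrightarrow> integrable (ivl l) (\<lambda>s. s powr \<alpha> * u' s * p' s)"
      by (rule Bochner_Integration.integrable_cong)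
        (auto simp: space_restrict_space powr_half_mult_self[of _ \<alpha>, symmetric] ac_simps)
    finally show ?thesis
      using p.integrable_u' p.integral_u'_eq_0 False by simp
  qed
  finally show ?thesis .
qed

lemma gen_opE:
  assumes "gen_op \<alpha> l u v" "0 < l" "0 \<le> \<alpha>" "\<alpha> < 2"
  obtains u' where "weighted_H1 \<alpha> l u u'" "L2_on l v" "weak_deriv l (\<lambda>x. x powr \<alpha> * u' x) v"
    "weak_deriv l u u'"
proof -
  obtain u' where u': "H1_alpha \<alpha> l u u'" "L2_on l (\<lambda>x. x powr \<alpha> * u' x)" "L2_on l v"
    "weak_deriv l (\<lambda>x. x powr \<alpha> * u' x) v"
    using assms(1) unfolding gen_op_def by (elim exE conjE)
  have "weighted_H1 \<alpha> l u u'" using u' assms(2-4) by (intro weighted_H1.intro)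
  moreover have "weak_deriv l u u'" using u'(1) by (simp add: H1_alpha_def)
  ultimately show ?thesis using u' that by simp
qed

text \<open>The right-hand side of \<open>green_identity\<close> is symmetric in the two
  functions.\<close>

lemma gen_op_symmetric:
  assumes "gen_op \<alpha> l u v" "gen_op \<alpha> l p q" and "0 < l" "0 \<le> \<alpha>" "\<alpha> < 2"
  shows "(\<integral>x. v x * p x \<partial>ivl l) = (\<integral>x. u x * q x \<partial>ivl l)"
proof -
  obtain u' where u': "weighted_H1 \<alpha> l u u'" "L2_on l v" "weak_deriv l (\<lambda>x. x powr \<alpha> * u' x) v"
    using gen_opE[OF assms(1) assms(3-5)] .
  obtain p' where p': "weighted_H1 \<alpha> l p p'" "L2_on l q" "weak_deriv l (\<lambda>x. x powr \<alpha> * p' x) q"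
    using gen_opE[OF assms(2) assms(3-5)] .
  show ?thesis
    using green_identity[OF u'(1) p'(1) u'(2,3)] green_identity[OF p'(1) u'(1) p'(2,3)]
    by (simp add: ac_simps)
qed

lemma gen_op_sq_integrable:
  "gen_op \<alpha> l u v \<Longrightarrow> sq_integrable (ivl l) u" "gen_op \<alpha> l u v \<Longrightarrow> sq_integrable (ivl l) v"
  by (auto simp: gen_op_def H1_alpha_def L2_on_iff)

section \<open>Backward uniqueness\<close>

lemma degenerate_solution_sq_integrable:
  assumes "degenerate_solution \<alpha> l T u0 u" "t \<in> {0<..T}"
  shows "sq_integrable (ivl l) (u t)"
  using assms(1)[unfolded degenerate_solution_def, THEN conjunct1, THEN bspec, OF assms(2)]
    gen_op_sq_integrable(1)[of \<alpha> l "u t"] by auto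

lemma has_L2_tderiv_iff:
  "has_L2_tderiv l T u t v \<longleftrightarrow> sq_integrable (ivl l) v \<and>
     ((\<lambda>s. l2_norm (ivl l) (\<lambda>x. (u s x - u t x) / (s - t) - v x)) \<longlongrightarrow> 0) (at t within {0<..T})"
  by (simp add: has_L2_tderiv_def L2_on_iff L2_dist_eq)

text \<open>Times to the left of \<open>t\<close> are always available, also for
  \<open>t = T\<close>, so limits along this filter are unique.\<close>

lemma at_within_Ioc_neq_bot: "0 < t \<Longrightarrow> t \<le> T \<Longrightarrow> at t within {0<..T} \<noteq> bot" for t T :: real
proof -
  assume t: "0 < t" "t \<le> T"
  have "at t within {0<..<t} \<noteq> bot"
    using t islimpt_greaterThanLessThan2[of 0 t] by (simp add: trivial_limit_within)
  moreover have "at t within {0<..<t} \<le> at t within {0<..T}"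
    using t by (intro at_le) auto
  ultimately show ?thesis by (auto dest: bot.extremum_uniqueI)
qed

text \<open>Identifies a prescribed time derivative with the value of the generator supplied by
  \<open>degenerate_solution\<close>.\<close>

lemma has_L2_tderiv_unique:
  assumes sol: "degenerate_solution \<alpha> l T u0 u" and t: "0 < t" "t \<le> T"
    and v: "has_L2_tderiv l T u t v" and w: "has_L2_tderiv l T u t w"
  shows "AE x in ivl l. v x = w x"
proof (rule l2_limit_unique[OF at_within_Ioc_neq_bot[OF t]])
  show "\<forall>\<^sub>F s in at t within {0<..T}. sq_integrable (ivl l) (\<lambda>x. (u s x - u t x) / (s - t))"
    unfolding eventually_at_filter
    using t by (auto intro!: always_eventually sq_integrable_divide sq_integrable_diff
        degenerate_solution_sq_integrable[OF sol])
qed (use v w in \<open>auto simp: has_L2_tderiv_iff\<close>)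

text \<open>The pairing \<open>k s\<close> of \<open>u s\<close> with \<open>u (c - s)\<close> has
  derivative 0 by symmetry of the generator. It vanishes at \<open>s = t\<close>, and at the fixed
  point of \<open>s \<mapsto> c - s\<close> it is a squared norm.\<close>

lemma degenerate_solution_zero_backward:
  assumes sol: "degenerate_solution \<alpha> l T u0 u" and l: "0 < l" and \<alpha>: "0 \<le> \<alpha>" "\<alpha> < 2"
    and t: "0 < t" "t \<le> T" and zero: "AE x in ivl l. u t x = 0"
  shows "AE x in ivl l. u (3/4 * t) x = 0"
proof -
  have "\<forall>s\<in>{0<..T}. \<exists>v. gen_op \<alpha> l (u s) v \<and> has_L2_tderiv l T u s v"
    using sol by (simp add: degenerate_solution_def)
  then obtain v where gen: "\<And>s. s \<in> {0<..T} \<Longrightarrow> gen_op \<alpha> l (u s) (v s)"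
    and der: "\<And>s. s \<in> {0<..T} \<Longrightarrow> has_L2_tderiv l T u s (v s)"
    by metis
  \<comment> \<open>Reflection about \<open>3/4 * t\<close> maps [t/2, t] to itself, so both times
    stay in the interval where the solution is differentiable.\<close>
  define c where "c = 3/2 * t"
  let ?S = "{t/2..t}"
  have S: "s \<in> {0<..T}" "c - s \<in> {0<..T}" "c - s \<in> ?S" if "s \<in> ?S" for s
    using that t by (auto simp: c_def)
  define k where "k s = (\<integral>x. u s x * u (c - s) x \<partial>ivl l)" for s
  have dk: "(k has_real_derivative 0) (at s within ?S)" if s: "s \<in> ?S" for s
  proof -
    have "((\<lambda>r. \<integral>x. u r x * u (c - r) x \<partial>ivl l) has_real_derivative
        (\<integral>x. v s x * u (c - s) x \<partial>ivl l) + (\<integral>x. u s x * (- v (c - s) x) \<partial>ivl l)) (at s within ?S)"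
    proof (rule has_real_derivative_l2_inner)
      show "sq_integrable (ivl l) (u r)" "sq_integrable (ivl l) (u (c - r))" if "r \<in> ?S" for r
        using S[OF that] degenerate_solution_sq_integrable[OF sol] by auto
      show "sq_integrable (ivl l) (v s)"
        using gen[OF S(1)[OF s]] by (rule gen_op_sq_integrable)
      show "sq_integrable (ivl l) (\<lambda>x. - v (c - s) x)"
        using sq_integrable_cmult[OF gen_op_sq_integrable(2)[OF gen[OF S(2)[OF s]]], of "-1"] by simp
      show "((\<lambda>r. l2_norm (ivl l) (\<lambda>x. (u r x - u s x) / (r - s) - v s x)) \<longlongrightarrow> 0) (at s within ?S)"
        using der[OF S(1)[OF s]] S(1) unfolding has_L2_tderiv_iff
        by (auto intro: tendsto_within_subset)
      \<comment> \<open>The reversed solution is differentiated by composing the limit at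
        \<open>c - s\<close> with the reflection of time.\<close>
      have lim: "filterlim (\<lambda>r. c - r) (at (c - s) within {0<..T}) (at s within ?S)"
        unfolding filterlim_at
      proof
        show "\<forall>\<^sub>F r in at s within ?S. c - r \<in> {0<..T} \<and> c - r \<noteq> c - s"
          unfolding eventually_at_filter using S(2) by (intro always_eventually) auto
        show "((\<lambda>r. c - r) \<longlongrightarrow> c - s) (at s within ?S)"
          by (intro tendsto_intros)
      qed
      have "((\<lambda>r. l2_norm (ivl l) (\<lambda>x. (u r x - u (c - s) x) / (r - (c - s)) - v (c - s) x)) \<longlongrightarrow> 0)
          (at (c - s) within {0<..T})"
        using der[OF S(2)[OF s]] by (simp add: has_L2_tderiv_iff)
      from filterlim_compose[OF this lim]
      have "((\<lambda>r. l2_norm (ivl l) (\<lambda>x. (u (c - r) x - u (c - s) x) / (c - r - (c - s)) - v (c - s) x))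
          \<longlongrightarrow> 0) (at s within ?S)" .
      \<comment> \<open>Reversing time changes the sign of the difference quotient, which the norm
        does not see.\<close>
      moreover have "l2_norm (ivl l) (\<lambda>x. (u (c - r) x - u (c - s) x) / (c - r - (c - s)) - v (c - s) x)
          = l2_norm (ivl l) (\<lambda>x. (u (c - r) x - u (c - s) x) / (r - s) - - v (c - s) x)" for r
      proof -
        have "(u (c - r) x - u (c - s) x) / (r - s) - - v (c - s) x
            = - 1 * ((u (c - r) x - u (c - s) x) / (c - r - (c - s)) - v (c - s) x)" for x
          using minus_divide_right[of "u (c - r) x - u (c - s) x" "r - s"] by simp
        then show ?thesis by (simp only: l2_norm_cmult abs_neg_one abs_minus_cancel abs_one mult_1)
      qed
      ultimately show "((\<lambda>r. l2_norm (ivl l) (\<lambda>x. (u (c - r) x - u (c - s) x) / (r - s) - - v (c - s) x))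
          \<longlongrightarrow> 0) (at s within ?S)" by simp
    qed (rule s)
    then show ?thesis
      using gen_op_symmetric[OF gen gen, OF S(1,2)[OF s] l \<alpha>] by (simp add: k_def[abs_def])
  qed
  have "\<exists>b. \<forall>s\<in>?S. k s = b"
    by (rule has_field_derivative_zero_constant) (use dk in auto)
  then have "k (3/4 * t) = k t" using t by auto
  also have "k t = 0"
    unfolding k_def by (rule integral_eq_zero_AE) (use zero in \<open>eventually_elim, simp\<close>)
  finally have "(\<integral>x. (u (3/4 * t) x)\<^sup>2 \<partial>ivl l) = 0"
    by (simp add: k_def c_def power2_eq_square)
  then have "l2_norm (ivl l) (u (3/4 * t)) = 0" by (simp add: l2_norm_def)
  then show ?thesis
    using l2_norm_eq_0_iff[OF degenerate_solution_sq_integrable[OF sol, of "3/4 * t"]] t by simp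
qed

text \<open>Iterating the backward step gives zeros at the times \<open>(3/4) ^ n * t\<close>, which
  decrease to 0. Continuity in L2 at time 0 carries the zero over to \<open>u0\<close>.\<close>

lemma degenerate_solution_zero_imp_initial_zero:
  assumes sol: "degenerate_solution \<alpha> l T u0 u" and l: "0 < l" and \<alpha>: "0 \<le> \<alpha>" "\<alpha> < 2"
    and t: "0 < t" "t \<le> T" and u0: "L2_on l u0" and zero: "AE x in ivl l. u t x = 0"
  shows "AE x in ivl l. u0 x = 0"
proof -
  let ?t = "\<lambda>n. (3/4) ^ n * t"
  have t_pos: "0 < ?t n" for n using t by simp
  have t_le: "?t n \<le> T" for n
  proof -
    have "?t n \<le> 1 * t" using t by (intro mult_right_mono power_le_one) auto
    then show ?thesis using t by linarith
  qed
  have zero_n: "AE x in ivl l. u (?t n) x = 0" for n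
  proof (induction n)
    case (Suc n)
    show ?case
      using degenerate_solution_zero_backward[OF sol l \<alpha> t_pos t_le Suc] by (simp add: mult.assoc)
  qed (use zero in simp)
  have "?t \<longlonglongrightarrow> 0 * t" by (intro tendsto_mult_right LIMSEQ_power_zero) simp
  then have "filterlim ?t (at_right 0) sequentially"
    using t by (simp add: filterlim_at)
  moreover have "((\<lambda>s. l2_norm (ivl l) (\<lambda>x. u s x - u0 x)) \<longlongrightarrow> 0) (at_right 0)"
    using sol by (simp add: degenerate_solution_def L2_dist_eq)
  ultimately have lim: "(\<lambda>n. l2_norm (ivl l) (\<lambda>x. u (?t n) x - u0 x)) \<longlonglongrightarrow> 0"
    by (rule filterlim_compose[rotated])
  have 0: "sq_integrable (ivl l) (\<lambda>x. 0)" by (simp add: sq_integrable_def)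
  have u0': "sq_integrable (ivl l) u0" using u0 by (simp add: L2_on_iff)
  have sq: "sq_integrable (ivl l) (u (?t n))" for n
    using t_pos t_le by (intro degenerate_solution_sq_integrable[OF sol]) auto
  have "l2_norm (ivl l) (\<lambda>x. u (?t n) x - 0) = 0" for n
    using l2_norm_eq_0_iff[OF sq, of n] zero_n[of n] by simp
  then have lim0: "(\<lambda>n. l2_norm (ivl l) (\<lambda>x. u (?t n) x - 0)) \<longlonglongrightarrow> 0" by simp
  \<comment> \<open>The sequence of states converges both to \<open>u0\<close> and to 0.\<close>
  show ?thesis
    by (rule l2_limit_unique[OF sequentially_bot _ u0' lim 0 lim0]) (simp add: sq)
qed

section \<open>Identification of the power\<close>

text \<open>Since \<open>x < 1\<close>, the weight \<open>x powr \<alpha> - x powr \<beta>\<close>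
  is positive, so \<open>u'\<close> is \<open>c\<close> over a positive function. A nonzero
  \<open>c\<close> contradicts the zero mean for \<open>\<alpha> < 1\<close> and the finite energy
  for \<open>\<alpha> \<ge> 1\<close>.\<close>

lemma common_derivative_zero:
  assumes l01: "0 < l" "l \<le> 1" and less: "\<alpha> < \<beta>"
    and H: "weighted_H1 \<alpha> l u u'"
    and c: "AE x in ivl l. (x powr \<alpha> - x powr \<beta>) * u' x = c"
  shows "AE x in ivl l. u' x = 0"
proof -
  interpret weighted_H1 \<alpha> l u u' by (rule H)
  have pos: "0 < x powr \<alpha> - x powr \<beta>" "x powr \<alpha> - x powr \<beta> \<le> x powr \<alpha>" if "x \<in> {0<..<l}" for x
    using that l01 less powr_less_mono'[of x \<alpha> \<beta>] by auto
  have u'_eq: "AE x in ivl l. x \<in> {0<..<l} \<and> u' x = c / (x powr \<alpha> - x powr \<beta>)"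
    using c AE_space
  proof eventually_elim
    case (elim x)
    then have "x \<in> {0<..<l}" by (simp add: space_restrict_space)
    then show ?case using pos[of x] elim by (simp add: field_simps)
  qed
  have "c = 0"
  proof (rule ccontr)
    assume "c \<noteq> 0"
    show False
    proof (cases "\<alpha> < 1")
      case True
      have "(\<integral>x. u' x / c \<partial>ivl l) = 0" using integral_u'_eq_0[OF True] by simp
      moreover have ge: "AE x in ivl l. 0 < u' x / c"
        using u'_eq by eventually_elim (use pos \<open>c \<noteq> 0\<close> in auto)
      moreover have "integrable (ivl l) (\<lambda>x. u' x / c)" using integrable_u'[OF True] by simp
      ultimately have "AE x in ivl l. u' x / c = 0"
        by (subst (asm) integral_nonneg_eq_0_iff_AE) (auto elim: eventually_mono)
      then have "AE x in ivl l. False" using ge by eventually_elim linarith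
      then show False using not_AE_False_ivl[OF l] by simp
    next
      case False
      show False
      proof (rule integrable_not_ge_inverse[OF energy_integrable _ l order.refl])
        show "0 < c\<^sup>2" using \<open>c \<noteq> 0\<close> by simp
        show "AE x in ivl l. x < l \<longrightarrow> c\<^sup>2 / x \<le> x powr \<alpha> * (u' x)\<^sup>2"
          using u'_eq
        proof eventually_elim
          case (elim x)
          let ?d = "x powr \<alpha> - x powr \<beta>"
          have x: "x \<in> {0<..<l}" "0 < x" "x < 1" using elim l01 by auto
          \<comment> \<open>The weight \<open>?d\<close> is bounded by
            \<open>x powr \<alpha>\<close> and also by \<open>x\<close>. Using each bound once gives
            \<open>?d * ?d \<le> x powr \<alpha> * x\<close>, which is the required lower bound on
            the energy density.\<close>
          have "x powr \<alpha> \<le> x powr 1" using x False by (intro powr_mono') auto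
          then have "?d \<le> x" using pos(2)[OF x(1)] x by (simp only: powr_one)
          then have "?d * ?d \<le> x powr \<alpha> * x"
            using pos[OF x(1)] x by (intro mult_mono) simp_all
          then have "c\<^sup>2 * (?d * ?d) \<le> c\<^sup>2 * (x powr \<alpha> * x)"
            by (rule mult_left_mono) simp
          then have "c\<^sup>2 / x \<le> x powr \<alpha> * (c\<^sup>2 / (?d * ?d))"
            using x pos[OF x(1)] by (simp add: divide_le_eq le_divide_eq ac_simps)
          then show ?case using elim by (simp add: power_divide power2_eq_square)
        qed
      qed
    qed
  qed
  show ?thesis using u'_eq by eventually_elim (simp add: \<open>c = 0\<close>)
qed

lemma ae_eq_on_sym: "ae_eq_on l f g \<Longrightarrow> ae_eq_on l g f"
  unfolding ae_eq_on_iff by (erule eventually_mono) simp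

lemma power_unique_less:
  fixes l T t0 \<alpha>1 \<alpha>2 :: real
  assumes l: "0 < l" "l \<le> 1"
    and u0: "L2_on l u0" "\<not> ae_eq_on l u0 (\<lambda>x. 0)"
    and \<alpha>1: "0 \<le> \<alpha>1" "\<alpha>1 < 2" and \<alpha>2: "0 \<le> \<alpha>2" "\<alpha>2 < 2"
    and sol1: "degenerate_solution \<alpha>1 l T u0 u1"
    and sol2: "degenerate_solution \<alpha>2 l T u0 u2"
    and t0: "0 < t0" "t0 \<le> T"
    and v1: "has_L2_tderiv l T u1 t0 v1" and v2: "has_L2_tderiv l T u2 t0 v2"
    and v: "ae_eq_on l v1 v2"
    and w1: "weak_deriv l (u1 t0) w1" and w2: "weak_deriv l (u2 t0) w2"
    and w: "ae_eq_on l w1 w2"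
    and less: "\<alpha>1 < \<alpha>2"
  shows False
proof -
  obtain g1 where g1: "gen_op \<alpha>1 l (u1 t0) g1" "has_L2_tderiv l T u1 t0 g1"
    using sol1[unfolded degenerate_solution_def, THEN conjunct1, THEN bspec, of t0] t0 by auto
  obtain g2 where g2: "gen_op \<alpha>2 l (u2 t0) g2" "has_L2_tderiv l T u2 t0 g2"
    using sol2[unfolded degenerate_solution_def, THEN conjunct1, THEN bspec, of t0] t0 by auto
  \<comment> \<open>The hypothesis concerns the given derivatives \<open>v1\<close> and
    \<open>v2\<close>; uniqueness transfers it to the generator values \<open>g1\<close> and
    \<open>g2\<close>.\<close>
  have g_eq: "AE x in ivl l. g1 x = g2 x"
    using has_L2_tderiv_unique[OF sol1 t0 g1(2) v1] has_L2_tderiv_unique[OF sol2 t0 g2(2) v2]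
      v[unfolded ae_eq_on_iff]
    by eventually_elim simp
  obtain d1 where d1: "weighted_H1 \<alpha>1 l (u1 t0) d1" "weak_deriv l (\<lambda>x. x powr \<alpha>1 * d1 x) g1"
    "weak_deriv l (u1 t0) d1"
    using gen_opE[OF g1(1) l(1) \<alpha>1] .
  obtain d2 where d2: "weighted_H1 \<alpha>2 l (u2 t0) d2" "weak_deriv l (\<lambda>x. x powr \<alpha>2 * d2 x) g2"
    "weak_deriv l (u2 t0) d2"
    using gen_opE[OF g2(1) l(1) \<alpha>2] .
  \<comment> \<open>In the same way, uniqueness of weak derivatives passes from \<open>w1\<close>
    and \<open>w2\<close> to the representatives that carry energy and flux.\<close>
  have d_eq: "AE x in ivl l. d1 x = d2 x"
    using weak_deriv_unique[OF d1(3) w1 l(1)] weak_deriv_unique[OF d2(3) w2 l(1)]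
      w[unfolded ae_eq_on_iff]
    by eventually_elim simp
  note g1_int = sq_integrable_ivl_integrable[OF gen_op_sq_integrable(2)[OF g1(1)]]
  note g2_int = sq_integrable_ivl_integrable[OF gen_op_sq_integrable(2)[OF g2(1)]]
  obtain c1 where c1: "AE s in ivl l. s powr \<alpha>1 * d1 s = c1 + (\<integral>x. indicator {..s} x * g1 x \<partial>ivl l)"
    using weak_deriv_primitive[OF d1(2) g1_int l(1)] .
  obtain c2 where c2: "AE s in ivl l. s powr \<alpha>2 * d2 s = c2 + (\<integral>x. indicator {..s} x * g2 x \<partial>ivl l)"
    using weak_deriv_primitive[OF d2(2) g2_int l(1)] .
  have V_eq: "(\<integral>x. indicator {..s} x * g1 x \<partial>ivl l) = (\<integral>x. indicator {..s} x * g2 x \<partial>ivl l)" for s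
  proof (rule integral_cong_AE)
    show "AE x in ivl l. indicator {..s} x * g1 x = indicator {..s} x * g2 x"
      using g_eq by eventually_elim simp
    have [measurable]: "g1 \<in> borel_measurable (ivl l)" "g2 \<in> borel_measurable (ivl l)"
      using g1_int g2_int by auto
    show "(\<lambda>x. indicator {..s} x * g1 x) \<in> borel_measurable (ivl l)"
      "(\<lambda>x. indicator {..s} x * g2 x) \<in> borel_measurable (ivl l)"
      by (simp_all add: indicator_def)
  qed
  \<comment> \<open>Both fluxes are a constant plus the same primitive, so their difference is
    constant.\<close>
  have "AE x in ivl l. (x powr \<alpha>1 - x powr \<alpha>2) * d1 x = c1 - c2"
    using c1 c2 d_eq by eventually_elim (simp add: left_diff_distrib V_eq)
  then have d1_0: "AE x in ivl l. d1 x = 0"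
    by (rule common_derivative_zero[OF l less d1(1)])
  \<comment> \<open>The trace condition at \<open>l\<close> writes \<open>u1 t0\<close> as minus
    this tail integral, so a zero derivative makes the state zero.\<close>
  have "(\<integral>s. indicator {..s} x * d1 s \<partial>ivl l) = 0" for x
    by (rule integral_eq_zero_AE) (use d1_0 in \<open>eventually_elim, simp\<close>)
  then have "AE x in ivl l. u1 t0 x = 0" using weighted_H1.u_eq[OF d1(1)] by simp
  then have "AE x in ivl l. u0 x = 0"
    by (rule degenerate_solution_zero_imp_initial_zero[OF sol1 l(1) \<alpha>1 t0 u0(1)])
  then show False using u0(2) by (simp add: ae_eq_on_iff)
qed

theorem theorem3p5:
  fixes l T t0 \<alpha>1 \<alpha>2 :: real
    and u0 :: "real \<Rightarrow> real"
    and u1 u2 :: "real \<Rightarrow> real \<Rightarrow> real"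
    and v1 v2 w1 w2 :: "real \<Rightarrow> real"
  assumes "0 < l" "l \<le> 1" "0 < T"
    and "L2_on l u0" "\<not> ae_eq_on l u0 (\<lambda>x. 0)"
    and "0 \<le> \<alpha>1" "\<alpha>1 < 2" "0 \<le> \<alpha>2" "\<alpha>2 < 2"
    and "degenerate_solution \<alpha>1 l T u0 u1"
    and "degenerate_solution \<alpha>2 l T u0 u2"
    and "0 < t0" "t0 \<le> T"
    and "has_L2_tderiv l T u1 t0 v1" "has_L2_tderiv l T u2 t0 v2"
    and "ae_eq_on l v1 v2"
    and "weak_deriv l (u1 t0) w1" "weak_deriv l (u2 t0) w2"
    and "ae_eq_on l w1 w2"
  shows "\<alpha>1 = \<alpha>2"
proof (rule linorder_cases[of \<alpha>1 \<alpha>2])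
  assume "\<alpha>1 < \<alpha>2"
  then show ?thesis
    using power_unique_less[OF assms(1,2,4-19)] by simp
next
  \<comment> \<open>The two problems exchange roles; the almost-everywhere equalities are reversed
    accordingly.\<close>
  assume "\<alpha>2 < \<alpha>1"
  then show ?thesis
    using power_unique_less[OF assms(1,2,4,5,8,9,6,7,11,10,12,13,15,14)
        ae_eq_on_sym[OF assms(16)] assms(18,17) ae_eq_on_sym[OF assms(19)]] by simp
qed

end
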